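(* Let $(\xi_t,X_\tau)$ be a cyclic-independent conjugate process and let $\mu$ be a diffraction of $(\xi_t)$. Then, for all $j\in\mathbb{N}$ and all $1\le t\le n$, it holds that $$\widehat W_{tj}=W_{tj}+\langle\varepsilon_t,\psi_j\rangle+\widehat\rho_{tj}$$ almost surely, where $\widehat\rho_{tj}$ is a random variable satisfying $$|\widehat\rho_{tj}|\le\|\widehat{\mathbb{E}}F_0-\mathbb{E}F_0\|+2|\mu|^{1/2}\|\widehat\psi_j-\psi_j\|.$$ Moreover, the innovations $(\langle\varepsilon_t,\psi_j\rangle:j\in\mathbb{N},\,t=0,1,\dots)$ are such that (i) $\mathbb{E}[\langle\varepsilon_t,\psi_j\rangle\mid\Xi]=0$ for all $t$ and $j$; (ii) $\mathbb{E}[\langle\varepsilon_t,\psi_j\rangle\cdot\langle\varepsilon_s,\psi_i\rangle\mid\Xi]=0$ for all $j,i$ and all $t\ne s$; (iii) $\mathbb{E}[W_{tj}\cdot\langle\varepsilon_s,\psi_i\rangle\mid\Xi]=0$ for all $t,s$ and all $j,i$; (iv) $|\langle\varepsilon_t,\psi_j\rangle|\le\|\widehat F_t-F_t\|$ for all $t$ and $j$.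
   Context: Let $(\Omega,\mathscr{A},\mathbb{P})$ be a probability space and $M_1(\mathbb{R})$ the set of Borel probability measures on $\mathbb{R}$ with the topology of weak convergence. Standing assumption: $(\xi_t:t=0,1,\dots)$ is a (strictly) stationary sequence of random elements of $M_1(\mathbb{R})$. Put $\Xi:=\sigma(\xi_0,\xi_1,\dots)$. The baricenter $\mathbb{E}\xi_0$ is the unique element of $M_1(\mathbb{R})$ with $\mathbb{E}\int f\,d\xi_0=\int f\,d\mathbb{E}\xi_0$ for all continuous bounded $f$. Conjugate process: a pair $(\xi_t,X_\tau)$ where $(X_\tau:\tau\ge0)$ is a real-valued process such that for every Borel $B$, every $t=0,1,\dots$ and $\tau\in[t,t+1)$, $\mathbb{P}[X_\tau\in B\mid\Xi]=\xi_t(B)$ a.s. It is cyclic-independent if, conditionally on $\Xi$, the processes $(X_\tau:\tau\in[t,t+1))$, $t=0,1,\dots$, form an independent sequence. A finite Borel measure $\mu$ on $\mathbb{R}$ is a diffraction of $(\xi_t)$ if it is equivalent (mutually absolutely continuous) to Lebesgue measure on some interval containing the support of $\mathbb{E}\xi_0$; $|\mu|:=\mu(\mathbb{R})$, and $\langle\cdot,\cdot\rangle$, $\|\cdot\|$ are the inner product and norm of $L^2(\mu)$. Put $F_t(x):=\xi_t(-\infty,x]$, $\mathbb{E}F_0(x):=\mathbb{E}\xi_0(-\infty,x]$, $C_k(x,y):=\mathrm{Cov}(F_0(x),F_k(y))$, and $C_k^\mu f(x):=\int C_k(x,y)f(y)\,\mu(dy)$ on $L^2(\mu)$. Fix an integer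 $p$ with $1\le p<n$. $R^\mu$ is the integral operator on $L^2(\mu)$ with kernel $R_\mu(x,y):=\sum_{k=1}^p\int C_k(x,z)C_k(y,z)\,\mu(dz)$; $(\theta_j:j\in\mathbb{N})$ is the non-increasing sequence of its eigenvalues (with multiplicity; it contains zeros if and only if $R^\mu$ has finite rank), with $L^2(\mu)$-orthonormal eigenfunctions $\psi_j$, $R^\mu\psi_j=\theta_j\psi_j$. Standing assumption: $\overline{\mathrm{Ran}(R^\mu)}=\overline{\mathrm{Ran}(C_0^\mu)}$. Put $W_{tj}:=\langle F_t-\mathbb{E}F_0,\psi_j\rangle$. Sampling and estimators: in each cycle $t$ one observes $X_{1t},\dots,X_{q_t,t}$ ($q_t\ge1$), values $X_\tau$ at $q_t$ times $\tau\in[t,t+1)$. Put $\widehat F_t(x):=\frac1{q_t}\sum_{i=1}^{q_t}\mathbb{I}_{[X_{it}\le x]}$, $\varepsilon_t:=\widehat F_t-F_t$, $\widehat{\mathbb{E}}F_0(x):=\frac1n\sum_{t=1}^n\widehat F_t(x)$, $$\widehat C_k(x,y):=\frac1{n-p}\sum_{t=1}^{n-p}\big(\widehat F_t(x)-\widehat{\mathbb{E}}F_0(x)\big)\big(\widehat F_{t+k}(y)-\widehat{\mathbb{E}}F_0(y)\big),\qquad \widehat R_\mu(x,y):=\sum_{k=1}^p\int\widehat C_k(x,z)\widehat C_k(y,z)\,\mu(dz).$$ $\widehat R^\mu$ is the (finite-rank) integral operator on $L^2(\mu)$ with kernel $\widehat R_\mu$, with non-increasing sequence of eigenvalues $(\widehat\theta_j:j\in\mathbb{N})$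 (with multiplicity, continued by zeros) and $L^2(\mu)$-orthonormal eigenfunctions $\widehat\psi_j$ (random elements of $L^2(\mu)$), $\widehat R^\mu\widehat\psi_j=\widehat\theta_j\widehat\psi_j$. Put $\widehat W_{tj}:=\langle\widehat F_t-\widehat{\mathbb{E}}F_0,\widehat\psi_j\rangle$ for $1\le t\le n$. *)

theory Defs
  imports "HOL-Probability.Probability"
begin

definition bcont :: "(real \<Rightarrow> real) \<Rightarrow> bool" where
  "bcont f \<longleftrightarrow> continuous_on UNIV f \<and> bounded (range f)"

definition weak_topology :: "real measure topology" where
  "weak_topology = topology_generated_by
     {{\<nu>. real_distribution \<nu> \<and> (\<integral>x. f x \<partial>\<nu>) \<in> U} | f U. bcont f \<and> open U}"

definition weak_borel :: "real measure measure" where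
  "weak_borel = sigma (topspace weak_topology) {U. openin weak_topology U}"

definition stationary_random_measures :: "'a measure \<Rightarrow> (nat \<Rightarrow> 'a \<Rightarrow> real measure) \<Rightarrow> bool" where
  "stationary_random_measures M \<xi> \<longleftrightarrow>
     (\<forall>t. \<xi> t \<in> measurable M weak_borel) \<and>
     (\<forall>s. distr M (PiM UNIV (\<lambda>_::nat. weak_borel)) (\<lambda>\<omega> t. \<xi> (t + s) \<omega>)
        = distr M (PiM UNIV (\<lambda>_::nat. weak_borel)) (\<lambda>\<omega> t. \<xi> t \<omega>))"

text \<open>Only the space and the measurable sets of this measure are used: it serves as
  the sub-\<open>\<sigma>\<close>-algebra argument of \<open>real_cond_exp\<close>.\<close>

definition Xi_alg :: "'a measure \<Rightarrow> (nat \<Rightarrow> 'a \<Rightarrow> real measure) \<Rightarrow> 'a measure" where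
  "Xi_alg M \<xi> = sigma (space M) (\<Union>t. {\<xi> t -` A \<inter> space M | A. A \<in> sets weak_borel})"

definition barycenter :: "'a measure \<Rightarrow> ('a \<Rightarrow> real measure) \<Rightarrow> real measure" where
  "barycenter M \<zeta> = (THE \<nu>. real_distribution \<nu> \<and>
     (\<forall>f. bcont f \<longrightarrow> (\<integral>\<omega>. (\<integral>x. f x \<partial>\<zeta> \<omega>) \<partial>M) = (\<integral>x. f x \<partial>\<nu>)))"

definition mean_cdf :: "'a measure \<Rightarrow> (nat \<Rightarrow> 'a \<Rightarrow> real measure) \<Rightarrow> real \<Rightarrow> real" where
  "mean_cdf M \<xi> x = cdf (barycenter M (\<xi> 0)) x"

definition conjugate_process ::
  "'a measure \<Rightarrow> (nat \<Rightarrow> 'a \<Rightarrow> real measure) \<Rightarrow> (real \<Rightarrow> 'a \<Rightarrow> real) \<Rightarrow> bool" where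
  "conjugate_process M \<xi> X \<longleftrightarrow>
     (\<forall>\<tau>\<ge>0. X \<tau> \<in> borel_measurable M) \<and>
     (\<forall>B\<in>sets borel. \<forall>t. \<forall>\<tau>\<in>{real t..<real t + 1}.
        AE \<omega> in M. real_cond_exp M (Xi_alg M \<xi>) (indicator (X \<tau> -` B \<inter> space M)) \<omega>
                   = measure (\<xi> t \<omega>) B)"

definition cycle_alg :: "'a measure \<Rightarrow> (real \<Rightarrow> 'a \<Rightarrow> real) \<Rightarrow> nat \<Rightarrow> 'a measure" where
  "cycle_alg M X t = sigma (space M)
     (\<Union>\<tau>\<in>{real t..<real t + 1}. {X \<tau> -` B \<inter> space M | B. B \<in> sets borel})"

definition cyclic_independent ::
  "'a measure \<Rightarrow> (nat \<Rightarrow> 'a \<Rightarrow> real measure) \<Rightarrow> (real \<Rightarrow> 'a \<Rightarrow> real) \<Rightarrow> bool" where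
  "cyclic_independent M \<xi> X \<longleftrightarrow>
     (\<forall>J A. finite J \<longrightarrow> J \<noteq> {} \<longrightarrow> (\<forall>t\<in>J. A t \<in> sets (cycle_alg M X t)) \<longrightarrow>
        (AE \<omega> in M. real_cond_exp M (Xi_alg M \<xi>) (indicator (\<Inter>t\<in>J. A t)) \<omega>
                  = (\<Prod>t\<in>J. real_cond_exp M (Xi_alg M \<xi>) (indicator (A t)) \<omega>)))"

definition msupport :: "real measure \<Rightarrow> real set" where
  "msupport \<nu> = {x. \<forall>U. open U \<longrightarrow> x \<in> U \<longrightarrow> emeasure \<nu> U > 0}"

definition diffraction ::
  "'a measure \<Rightarrow> (nat \<Rightarrow> 'a \<Rightarrow> real measure) \<Rightarrow> real measure \<Rightarrow> bool" where
  "diffraction M \<xi> \<mu> \<longleftrightarrow> finite_measure \<mu> \<and> sets \<mu> = sets borel \<and>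
     (\<exists>I. is_interval I \<and> msupport (barycenter M (\<xi> 0)) \<subseteq> I \<and>
          absolutely_continuous \<mu> (density lborel (indicator I)) \<and>
          absolutely_continuous (density lborel (indicator I)) \<mu>)"

text \<open>Elements of \<open>L\<^sup>2(\<mu>)\<close> are represented by square integrable functions, and equality in
  \<open>L\<^sup>2(\<mu>)\<close> is equality almost everywhere.\<close>

definition L2_space :: "real measure \<Rightarrow> (real \<Rightarrow> real) set" where
  "L2_space \<mu> = {f \<in> borel_measurable \<mu>. integrable \<mu> (\<lambda>x. (f x)\<^sup>2)}"

definition L2_inner :: "real measure \<Rightarrow> (real \<Rightarrow> real) \<Rightarrow> (real \<Rightarrow> real) \<Rightarrow> real" where
  "L2_inner \<mu> f g = (\<integral>x. f x * g x \<partial>\<mu>)"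

definition L2_norm :: "real measure \<Rightarrow> (real \<Rightarrow> real) \<Rightarrow> real" where
  "L2_norm \<mu> f = sqrt (L2_inner \<mu> f f)"

definition L2_open :: "real measure \<Rightarrow> (real \<Rightarrow> real) set \<Rightarrow> bool" where
  "L2_open \<mu> U \<longleftrightarrow> U \<subseteq> L2_space \<mu> \<and>
     (\<forall>f\<in>U. \<exists>r>0. \<forall>g\<in>L2_space \<mu>. L2_norm \<mu> (\<lambda>x. g x - f x) < r \<longrightarrow> g \<in> U)"

definition L2_borel :: "real measure \<Rightarrow> (real \<Rightarrow> real) measure" where
  "L2_borel \<mu> = sigma (L2_space \<mu>) {U. L2_open \<mu> U}"

definition L2_closure :: "real measure \<Rightarrow> (real \<Rightarrow> real) set \<Rightarrow> (real \<Rightarrow> real) set" where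
  "L2_closure \<mu> S = {f \<in> L2_space \<mu>. \<forall>e>0. \<exists>g\<in>S. L2_norm \<mu> (\<lambda>x. f x - g x) < e}"

text \<open>\<open>has_L2_dim \<mu> V d\<close>: the image of \<open>V\<close> in \<open>L\<^sup>2(\<mu>)\<close> has a linear basis of \<open>d\<close> elements.\<close>

definition has_L2_dim :: "real measure \<Rightarrow> (real \<Rightarrow> real) set \<Rightarrow> nat \<Rightarrow> bool" where
  "has_L2_dim \<mu> V d \<longleftrightarrow> (\<exists>b::nat \<Rightarrow> real \<Rightarrow> real.
     (\<forall>i<d. b i \<in> V) \<and>
     (\<forall>c::nat \<Rightarrow> real. (AE x in \<mu>. (\<Sum>i<d. c i * b i x) = 0) \<longrightarrow> (\<forall>i<d. c i = 0)) \<and>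
     (\<forall>f\<in>V. \<exists>c::nat \<Rightarrow> real. AE x in \<mu>. f x = (\<Sum>i<d. c i * b i x)))"

definition int_op :: "real measure \<Rightarrow> (real \<Rightarrow> real \<Rightarrow> real) \<Rightarrow> (real \<Rightarrow> real) \<Rightarrow> real \<Rightarrow> real" where
  "int_op \<mu> K f x = (\<integral>y. K x y * f y \<partial>\<mu>)"

definition op_range :: "real measure \<Rightarrow> (real \<Rightarrow> real \<Rightarrow> real) \<Rightarrow> (real \<Rightarrow> real) set" where
  "op_range \<mu> K = int_op \<mu> K ` L2_space \<mu>"

definition eigenspace :: "real measure \<Rightarrow> (real \<Rightarrow> real \<Rightarrow> real) \<Rightarrow> real \<Rightarrow> (real \<Rightarrow> real) set" where
  "eigenspace \<mu> K r = {f \<in> L2_space \<mu>. AE x in \<mu>. int_op \<mu> K f x = r * f x}"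

text \<open>\<open>eigensystem \<mu> K \<theta> \<psi>\<close>: \<open>\<theta>\<close> lists in non-increasing order the eigenvalues of the
  (compact, nonnegative) operator with kernel \<open>K\<close>, each nonzero one as often as its multiplicity;
  zeros are listed exactly when the operator has finite rank.  The functions \<open>\<psi> j\<close> are corresponding
  orthonormal eigenfunctions.  Finiteness of the index sets is required because \<open>card\<close> of an
  infinite set is \<open>0\<close>.\<close>

definition eigensystem ::
  "real measure \<Rightarrow> (real \<Rightarrow> real \<Rightarrow> real) \<Rightarrow> (nat \<Rightarrow> real) \<Rightarrow> (nat \<Rightarrow> real \<Rightarrow> real) \<Rightarrow> bool" where
  "eigensystem \<mu> K \<theta> \<psi> \<longleftrightarrow>
     decseq \<theta> \<and>
     (\<forall>r. r \<noteq> 0 \<longrightarrow> finite {j. \<theta> j = r} \<and> has_L2_dim \<mu> (eigenspace \<mu> K r) (card {j. \<theta> j = r})) \<and>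
     ((\<exists>j. \<theta> j = 0) \<longleftrightarrow> (\<exists>d. has_L2_dim \<mu> (op_range \<mu> K) d)) \<and>
     (\<forall>j. \<psi> j \<in> eigenspace \<mu> K (\<theta> j)) \<and>
     (\<forall>i j. L2_inner \<mu> (\<psi> i) (\<psi> j) = (if i = j then 1 else 0))"

definition covariance :: "'a measure \<Rightarrow> ('a \<Rightarrow> real) \<Rightarrow> ('a \<Rightarrow> real) \<Rightarrow> real" where
  "covariance M Y Z = (\<integral>\<omega>. (Y \<omega> - (\<integral>\<omega>'. Y \<omega>' \<partial>M)) * (Z \<omega> - (\<integral>\<omega>'. Z \<omega>' \<partial>M)) \<partial>M)"

definition C_ker :: "'a measure \<Rightarrow> (nat \<Rightarrow> 'a \<Rightarrow> real measure) \<Rightarrow> nat \<Rightarrow> real \<Rightarrow> real \<Rightarrow> real" where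
  "C_ker M \<xi> k x y = covariance M (\<lambda>\<omega>. cdf (\<xi> 0 \<omega>) x) (\<lambda>\<omega>. cdf (\<xi> k \<omega>) y)"

text \<open>The common form of the population and the sample version of the kernel \<open>R\<^sub>\<mu>\<close>.\<close>

definition R_ker :: "real measure \<Rightarrow> nat \<Rightarrow> (nat \<Rightarrow> real \<Rightarrow> real \<Rightarrow> real) \<Rightarrow> real \<Rightarrow> real \<Rightarrow> real" where
  "R_ker \<mu> p C x y = (\<Sum>k=1..p. \<integral>z. C k x z * C k y z \<partial>\<mu>)"

definition W :: "'a measure \<Rightarrow> (nat \<Rightarrow> 'a \<Rightarrow> real measure) \<Rightarrow> real measure \<Rightarrow>
    (nat \<Rightarrow> real \<Rightarrow> real) \<Rightarrow> nat \<Rightarrow> nat \<Rightarrow> 'a \<Rightarrow> real" where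
  "W M \<xi> \<mu> \<psi> t j \<omega> = L2_inner \<mu> (\<lambda>x. cdf (\<xi> t \<omega>) x - mean_cdf M \<xi> x) (\<psi> j)"

text \<open>The observation \<open>X\<^sub>i\<^sub>t\<close> is \<open>X (s t i)\<close>, for \<open>i \<in> {1..q t}\<close>.\<close>

definition sampling_scheme :: "(nat \<Rightarrow> nat) \<Rightarrow> (nat \<Rightarrow> nat \<Rightarrow> real) \<Rightarrow> bool" where
  "sampling_scheme q s \<longleftrightarrow> (\<forall>t. q t \<ge> 1 \<and> (\<forall>i\<in>{1..q t}. s t i \<in> {real t..<real t + 1}))"

definition F_hat :: "(real \<Rightarrow> 'a \<Rightarrow> real) \<Rightarrow> (nat \<Rightarrow> nat) \<Rightarrow> (nat \<Rightarrow> nat \<Rightarrow> real) \<Rightarrow>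
    nat \<Rightarrow> 'a \<Rightarrow> real \<Rightarrow> real" where
  "F_hat X q s t \<omega> x = (1 / real (q t)) * (\<Sum>i=1..q t. if X (s t i) \<omega> \<le> x then 1 else 0)"

definition eps :: "(nat \<Rightarrow> 'a \<Rightarrow> real measure) \<Rightarrow> (real \<Rightarrow> 'a \<Rightarrow> real) \<Rightarrow> (nat \<Rightarrow> nat) \<Rightarrow>
    (nat \<Rightarrow> nat \<Rightarrow> real) \<Rightarrow> nat \<Rightarrow> 'a \<Rightarrow> real \<Rightarrow> real" where
  "eps \<xi> X q s t \<omega> x = F_hat X q s t \<omega> x - cdf (\<xi> t \<omega>) x"

definition mean_cdf_hat :: "(real \<Rightarrow> 'a \<Rightarrow> real) \<Rightarrow> (nat \<Rightarrow> nat) \<Rightarrow> (nat \<Rightarrow> nat \<Rightarrow> real) \<Rightarrow>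
    nat \<Rightarrow> 'a \<Rightarrow> real \<Rightarrow> real" where
  "mean_cdf_hat X q s n \<omega> x = (1 / real n) * (\<Sum>t=1..n. F_hat X q s t \<omega> x)"

definition C_hat :: "(real \<Rightarrow> 'a \<Rightarrow> real) \<Rightarrow> (nat \<Rightarrow> nat) \<Rightarrow> (nat \<Rightarrow> nat \<Rightarrow> real) \<Rightarrow>
    nat \<Rightarrow> nat \<Rightarrow> 'a \<Rightarrow> nat \<Rightarrow> real \<Rightarrow> real \<Rightarrow> real" where
  "C_hat X q s n p \<omega> k x y = (1 / real (n - p)) *
     (\<Sum>t=1..n-p. (F_hat X q s t \<omega> x - mean_cdf_hat X q s n \<omega> x) *
                 (F_hat X q s (t + k) \<omega> y - mean_cdf_hat X q s n \<omega> y))"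

definition W_hat :: "(real \<Rightarrow> 'a \<Rightarrow> real) \<Rightarrow> (nat \<Rightarrow> nat) \<Rightarrow> (nat \<Rightarrow> nat \<Rightarrow> real) \<Rightarrow>
    nat \<Rightarrow> real measure \<Rightarrow> (nat \<Rightarrow> 'a \<Rightarrow> real \<Rightarrow> real) \<Rightarrow> nat \<Rightarrow> nat \<Rightarrow> 'a \<Rightarrow> real" where
  "W_hat X q s n \<mu> \<psi>h t j \<omega> =
     L2_inner \<mu> (\<lambda>x. F_hat X q s t \<omega> x - mean_cdf_hat X q s n \<omega> x) (\<psi>h j \<omega>)"

definition innov :: "(nat \<Rightarrow> 'a \<Rightarrow> real measure) \<Rightarrow> (real \<Rightarrow> 'a \<Rightarrow> real) \<Rightarrow> (nat \<Rightarrow> nat) \<Rightarrow>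
    (nat \<Rightarrow> nat \<Rightarrow> real) \<Rightarrow> real measure \<Rightarrow> (nat \<Rightarrow> real \<Rightarrow> real) \<Rightarrow> nat \<Rightarrow> nat \<Rightarrow> 'a \<Rightarrow> real" where
  "innov \<xi> X q s \<mu> \<psi> t j \<omega> = L2_inner \<mu> (eps \<xi> X q s t \<omega>) (\<psi> j)"

text \<open>\<open>real_cond_exp\<close> is total (it is \<open>0\<close> for non-measurable arguments), so
  \<open>\<bbbE>[Y | G] = 0\<close> is stated together with integrability of \<open>Y\<close>.\<close>

definition cond_mean_zero :: "'a measure \<Rightarrow> 'a measure \<Rightarrow> ('a \<Rightarrow> real) \<Rightarrow> bool" where
  "cond_mean_zero M G Y \<longleftrightarrow> integrable M Y \<and> (AE \<omega> in M. real_cond_exp M G Y \<omega> = 0)"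

end

theory Submission
  imports Defs
begin

text \<open>
  Write \<open>F\<^sub>t\<close> for the distribution function of \<open>\<xi> t\<close>, \<open>Fh\<^sub>t\<close> for the empirical one in
  cycle \<open>t\<close>, \<open>E\<close> for the mean distribution function and \<open>Eh\<close> for its estimator.

  The decomposition is algebra in \<open>L\<^sup>2(\<mu>)\<close>.  Since \<open>W\<^sub>t\<^sub>j\<close> and the innovation add up to
  \<open>\<langle>Fh\<^sub>t - E, \<psi>\<^sub>j\<rangle>\<close>, the remainder is \<open>\<langle>Fh\<^sub>t - Eh, \<psi>h\<^sub>j - \<psi>\<^sub>j\<rangle> - \<langle>Eh - E, \<psi>\<^sub>j\<rangle>\<close>.
  The Cauchy-Schwarz inequality bounds it, because \<open>\<psi>\<^sub>j\<close> is a unit vector and \<open>Fh\<^sub>t - Eh\<close>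
  takes values in \<open>[-1, 1]\<close> (\<open>W_hat_remainder_bound\<close>).  The same inequality gives (iv).  The
  remainder is measurable because the inner product of a random half line indicator with a
  random element of \<open>L\<^sup>2(\<mu>)\<close> is a random variable (\<open>L2_inner_half_line_measurable\<close>).

  For (i) to (iii), the pointwise error \<open>\<epsilon>\<^sub>t(x) = Fh\<^sub>t(x) - F\<^sub>t(x)\<close> is conditionally centred
  given \<open>\<Xi>\<close> by the definition of a conjugate process, and a product \<open>\<epsilon>\<^sub>t(x) \<epsilon>\<^sub>r(y)\<close> of errors
  from different cycles is so by cyclic independence (\<open>cond_mean_zero_eps\<close>,
  \<open>cond_mean_zero_eps_mult\<close>).  A factor that is measurable with respect to \<open>\<Xi>\<close>, such as
  \<open>F\<^sub>t(x) - E(x)\<close>, can be pulled out (\<open>cond_mean_zero_mult\<close>).  Fubini's theorem carries these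
  statements from fixed points \<open>x\<close>, \<open>y\<close> to the inner products, one integral at a time
  (\<open>cond_mean_zero_integral\<close>).  It applies because \<open>(\<omega>, x) \<mapsto> F\<^sub>t(x)\<close> is jointly measurable and
  \<open>E\<close> is the distribution function of a probability measure, both consequences of the fact that
  a random element of the space of probability measures is a Markov kernel
  (\<open>weak_borel_measurable_imp_kernel\<close>, \<open>barycenter_real_distribution\<close>).
\<close>

section \<open>Square integrable functions\<close>

lemma L2_spaceD:
  assumes "f \<in> L2_space \<mu>"
  shows "f \<in> borel_measurable \<mu>" "integrable \<mu> (\<lambda>x. (f x)\<^sup>2)"
  using assms by (auto simp: L2_space_def)

lemma L2_space_bounded:
  assumes "finite_measure \<mu>" and [measurable]: "f \<in> borel_measurable \<mu>" and "\<And>x. \<bar>f x\<bar> \<le> c"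
  shows "f \<in> L2_space \<mu>"
proof -
  interpret finite_measure \<mu> by fact
  have "(f x)\<^sup>2 \<le> c\<^sup>2" for x
    using power_mono[OF assms(3)[of x], of 2] by simp
  then have "integrable \<mu> (\<lambda>x. (f x)\<^sup>2)"
    by (intro integrable_const_bound[where B="c\<^sup>2"]) auto
  then show ?thesis
    by (simp add: L2_space_def)
qed

lemma L2_mult_integrable:
  assumes f: "f \<in> L2_space \<mu>" and g: "g \<in> L2_space \<mu>"
  shows "integrable \<mu> (\<lambda>x. f x * g x)"
proof -
  note [measurable] = L2_spaceD(1)[OF f] L2_spaceD(1)[OF g]
  have "\<bar>f x * g x\<bar> \<le> (f x)\<^sup>2 + (g x)\<^sup>2" for x
  proof -
    have "2 * (\<bar>f x\<bar> * \<bar>g x\<bar>) \<le> (f x)\<^sup>2 + (g x)\<^sup>2"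
      using sum_squares_bound[of "\<bar>f x\<bar>" "\<bar>g x\<bar>"] by simp
    moreover have "0 \<le> \<bar>f x\<bar> * \<bar>g x\<bar>"
      by simp
    ultimately show ?thesis
      unfolding abs_mult by linarith
  qed
  then show ?thesis
    using Bochner_Integration.integrable_add[OF L2_spaceD(2)[OF f] L2_spaceD(2)[OF g]]
    by (rule_tac Bochner_Integration.integrable_bound) auto
qed

lemma L2_space_diff:
  assumes f: "f \<in> L2_space \<mu>" and g: "g \<in> L2_space \<mu>"
  shows "(\<lambda>x. f x - g x) \<in> L2_space \<mu>"
proof -
  note [measurable] = L2_spaceD(1)[OF f] L2_spaceD(1)[OF g]
  have "integrable \<mu> (\<lambda>x. (f x)\<^sup>2 + (g x)\<^sup>2 - 2 * (f x * g x))"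
    using L2_mult_integrable[OF f g] L2_spaceD(2)[OF f] L2_spaceD(2)[OF g] by simp
  then show ?thesis
    by (simp add: L2_space_def power2_diff mult.assoc)
qed

lemma L2_inner_diff_left:
  assumes "f \<in> L2_space \<mu>" "g \<in> L2_space \<mu>" "h \<in> L2_space \<mu>"
  shows "L2_inner \<mu> (\<lambda>x. f x - g x) h = L2_inner \<mu> f h - L2_inner \<mu> g h"
  using assms by (simp add: L2_inner_def left_diff_distrib L2_mult_integrable)

lemma L2_inner_diff_right:
  assumes "f \<in> L2_space \<mu>" "g \<in> L2_space \<mu>" "h \<in> L2_space \<mu>"
  shows "L2_inner \<mu> h (\<lambda>x. f x - g x) = L2_inner \<mu> h f - L2_inner \<mu> h g"
  using assms by (simp add: L2_inner_def right_diff_distrib L2_mult_integrable)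

lemma L2_inner_scaled_sum_left:
  assumes "\<And>i. i \<in> I \<Longrightarrow> f i \<in> L2_space \<mu>" "h \<in> L2_space \<mu>"
  shows "L2_inner \<mu> (\<lambda>x. c * (\<Sum>i\<in>I. f i x)) h = c * (\<Sum>i\<in>I. L2_inner \<mu> (f i) h)"
  using assms by (simp add: L2_inner_def mult.assoc sum_distrib_right L2_mult_integrable)

lemma L2_inner_self_nonneg: "0 \<le> L2_inner \<mu> f f"
  by (simp add: L2_inner_def)

lemma L2_Cauchy_Schwarz:
  assumes f: "f \<in> L2_space \<mu>" and g: "g \<in> L2_space \<mu>"
  shows "\<bar>L2_inner \<mu> f g\<bar> \<le> L2_norm \<mu> f * L2_norm \<mu> g"
proof -
  define A B C where "A = L2_inner \<mu> f f" and "B = L2_inner \<mu> g g" and "C = L2_inner \<mu> f g"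
  note [measurable] = L2_spaceD(1)[OF f] L2_spaceD(1)[OF g]
  note int = L2_mult_integrable[OF f f] L2_mult_integrable[OF f g] L2_mult_integrable[OF g g]
  have "C\<^sup>2 \<le> A * B"
  proof (cases "B = 0")
    case True
    then have "AE x in \<mu>. g x * g x = 0"
      using integral_nonneg_eq_0_iff_AE[OF int(3)] by (simp add: B_def L2_inner_def)
    then have "C = (\<integral>x. 0 \<partial>\<mu>)"
      unfolding C_def L2_inner_def by (intro integral_cong_AE) auto
    then show ?thesis
      using True by simp
  next
    case False
    \<comment> \<open>Up to the factor \<open>B\<^sup>2\<close>, the integrand is the squared residual of projecting \<open>f\<close> onto \<open>g\<close>.\<close>
    have "0 \<le> (\<integral>x. (B * f x - C * g x)\<^sup>2 \<partial>\<mu>)"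
      by simp
    also have "\<dots> = (\<integral>x. B\<^sup>2 * (f x * f x) - 2 * B * C * (f x * g x) + C\<^sup>2 * (g x * g x) \<partial>\<mu>)"
      by (simp add: power2_eq_square algebra_simps)
    also have "\<dots> = B\<^sup>2 * A - 2 * B * C * C + C\<^sup>2 * B"
      using int by (simp add: A_def B_def C_def L2_inner_def)
    also have "\<dots> = B * (A * B - C\<^sup>2)"
      by (simp add: power2_eq_square algebra_simps)
    finally show ?thesis
      using False L2_inner_self_nonneg[of \<mu> g] by (simp add: zero_le_mult_iff B_def[symmetric])
  qed
  then have "sqrt (C\<^sup>2) \<le> sqrt (A * B)"
    by (rule real_sqrt_le_mono)
  then show ?thesis
    by (simp add: A_def B_def C_def L2_norm_def real_sqrt_mult)
qed

lemma L2_norm_le_sqrt_measure: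
  assumes "finite_measure \<mu>" and [measurable]: "f \<in> borel_measurable \<mu>" and "\<And>x. \<bar>f x\<bar> \<le> 1"
  shows "L2_norm \<mu> f \<le> sqrt (measure \<mu> (space \<mu>))"
proof -
  interpret finite_measure \<mu> by fact
  have "f x * f x \<le> 1" for x
    using abs_le_square_iff[of "f x" 1] assms(3)[of x] by (simp add: power2_eq_square)
  then have "L2_inner \<mu> f f \<le> (\<integral>x. 1 \<partial>\<mu>)"
    unfolding L2_inner_def
    using L2_space_bounded[OF assms] by (intro integral_mono) (auto intro: L2_mult_integrable)
  then show ?thesis
    by (simp add: L2_norm_def)
qed

section \<open>Measurability of random inner products\<close>

lemma space_L2_borel: "space (L2_borel \<mu>) = L2_space \<mu>"
  by (auto simp: L2_borel_def L2_open_def intro!: space_measure_of)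

lemma L2_open_in_sets: "L2_open \<mu> U \<Longrightarrow> U \<in> sets (L2_borel \<mu>)"
  unfolding L2_borel_def by (subst sets_measure_of) (auto simp: L2_open_def)

text \<open>By the Cauchy-Schwarz inequality the inner product with a fixed function is continuous, so
  preimages of open sets are open in \<open>L\<^sup>2(\<mu>)\<close>.\<close>

lemma L2_inner_measurable:
  assumes g: "g \<in> L2_space \<mu>"
  shows "L2_inner \<mu> g \<in> borel_measurable (L2_borel \<mu>)"
proof (rule borel_measurableI)
  fix S :: "real set" assume S: "open S"
  have "\<exists>r>0. \<forall>h\<in>L2_space \<mu>. L2_norm \<mu> (\<lambda>x. h x - f x) < r \<longrightarrow> L2_inner \<mu> g h \<in> S"
    if f: "f \<in> L2_space \<mu>" "L2_inner \<mu> g f \<in> S" for f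
  proof -
    obtain e where e: "0 < e" "\<And>y. dist y (L2_inner \<mu> g f) < e \<Longrightarrow> y \<in> S"
      using S f(2) by (metis open_dist)
    have N: "0 < L2_norm \<mu> g + 1"
      using L2_inner_self_nonneg[of \<mu> g] by (simp add: L2_norm_def add_nonneg_pos)
    have "L2_inner \<mu> g h \<in> S"
      if h: "h \<in> L2_space \<mu>" "L2_norm \<mu> (\<lambda>x. h x - f x) < e / (L2_norm \<mu> g + 1)" for h
    proof (rule e(2))
      have pos: "0 \<le> L2_norm \<mu> (\<lambda>x. h x - f x)"
        by (simp add: L2_norm_def L2_inner_self_nonneg)
      have "dist (L2_inner \<mu> g h) (L2_inner \<mu> g f) \<le> L2_norm \<mu> g * L2_norm \<mu> (\<lambda>x. h x - f x)"
        using L2_Cauchy_Schwarz[OF g L2_space_diff[OF h(1) f(1)]]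
        by (simp add: L2_inner_diff_right g h f dist_real_def)
      also have "\<dots> \<le> (L2_norm \<mu> g + 1) * L2_norm \<mu> (\<lambda>x. h x - f x)"
        using pos by (simp add: mult_right_mono)
      also have "\<dots> < e"
        using h(2) N by (simp add: pos_less_divide_eq mult.commute)
      finally show "dist (L2_inner \<mu> g h) (L2_inner \<mu> g f) < e" .
    qed
    then show ?thesis
      using e(1) N by (intro exI[of _ "e / (L2_norm \<mu> g + 1)"]) auto
  qed
  then have "L2_open \<mu> (L2_inner \<mu> g -` S \<inter> L2_space \<mu>)"
    unfolding L2_open_def by fastforce
  then show "L2_inner \<mu> g -` S \<inter> space (L2_borel \<mu>) \<in> sets (L2_borel \<mu>)"
    by (simp add: space_L2_borel L2_open_in_sets)
qed

text \<open>The inner product of a random half line indicator with a random element of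
  \<open>L\<^sup>2(\<mu>)\<close> is a random variable: rounding the end point down to a grid leaves countably many
  indicators, and the inner products converge as the grid is refined.\<close>

lemma L2_inner_half_line_measurable:
  assumes "finite_measure \<mu>" and sets_\<mu>: "sets \<mu> = sets borel"
    and [measurable]: "Y \<in> borel_measurable M" and \<Phi>: "\<Phi> \<in> measurable M (L2_borel \<mu>)"
  shows "(\<lambda>\<omega>. L2_inner \<mu> (\<lambda>x. if Y \<omega> \<le> x then 1 else 0) (\<Phi> \<omega>)) \<in> borel_measurable M"
proof -
  interpret finite_measure \<mu> by fact
  have [measurable_cong]: "sets \<mu> = sets borel" by fact
  \<comment> \<open>Rounding down, not up: where \<open>Y \<omega> \<le> x\<close>, the approximating indicators are then
    constantly \<open>1\<close>, also at the jump \<open>x = Y \<omega>\<close>.\<close>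
  define a where "a m y = real_of_int \<lfloor>y * real (Suc m)\<rfloor> / real (Suc m)" for m :: nat and y :: real
  have a_le: "a m y \<le> y" for m y
    by (simp add: a_def field_simps del: of_nat_Suc)
  have a_ge: "y - 1 / real (Suc m) \<le> a m y" for m y
  proof -
    have "y * real (Suc m) - 1 \<le> real_of_int \<lfloor>y * real (Suc m)\<rfloor>"
      by linarith
    then have "(y * real (Suc m) - 1) / real (Suc m) \<le> a m y"
      unfolding a_def by (intro divide_right_mono) auto
    then show ?thesis
      by (simp add: diff_divide_distrib del: of_nat_Suc)
  qed
  have a_lim: "(\<lambda>m. a m y) \<longlonglongrightarrow> y" for y
  proof (rule tendsto_sandwich[of "\<lambda>m. y - 1 / real (Suc m)" _ _ "\<lambda>_. y"])
    have "(\<lambda>m. y - 1 / real (Suc m)) \<longlonglongrightarrow> y - 0"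
      by (intro tendsto_diff tendsto_const LIMSEQ_Suc lim_1_over_n)
    then show "(\<lambda>m. y - 1 / real (Suc m)) \<longlonglongrightarrow> y" by simp
  qed (use a_le a_ge in auto)
  have L2: "\<Phi> \<omega> \<in> L2_space \<mu>" if "\<omega> \<in> space M" for \<omega>
    using measurable_space[OF \<Phi> that] by (simp add: space_L2_borel)
  have ind_L2: "(\<lambda>x. if y \<le> x then 1 else 0) \<in> L2_space \<mu>" for y :: real
    by (rule L2_space_bounded[where c=1]) (auto simp: assms(1))
  have grid: "(\<lambda>\<omega>. L2_inner \<mu> (\<lambda>x. if a m (Y \<omega>) \<le> x then 1 else 0) (\<Phi> \<omega>)) \<in> borel_measurable M" for m
  proof -
    have "(\<lambda>\<omega>. (\<lambda>k \<omega>. L2_inner \<mu> (\<lambda>x. if real_of_int k / real (Suc m) \<le> x then 1 else 0) (\<Phi> \<omega>))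
        \<lfloor>Y \<omega> * real (Suc m)\<rfloor> \<omega>) \<in> borel_measurable M"
      by (rule measurable_compose_countable)
        (auto intro!: measurable_compose[OF \<Phi>] L2_inner_measurable ind_L2)
    then show ?thesis
      by (simp add: a_def)
  qed
  have "(\<lambda>m. L2_inner \<mu> (\<lambda>x. if a m (Y \<omega>) \<le> x then 1 else 0) (\<Phi> \<omega>))
      \<longlonglongrightarrow> L2_inner \<mu> (\<lambda>x. if Y \<omega> \<le> x then 1 else 0) (\<Phi> \<omega>)" if \<omega>: "\<omega> \<in> space M" for \<omega>
    unfolding L2_inner_def
  proof (rule integral_dominated_convergence[where w="\<lambda>x. \<bar>\<Phi> \<omega> x\<bar>"])
    note [measurable] = L2_spaceD(1)[OF L2[OF \<omega>]]
    show "(\<lambda>x. (if Y \<omega> \<le> x then 1 else 0) * \<Phi> \<omega> x) \<in> borel_measurable \<mu>"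
      "(\<lambda>x. (if a m (Y \<omega>) \<le> x then 1 else 0) * \<Phi> \<omega> x) \<in> borel_measurable \<mu>" for m
      by measurable
    have one: "(\<lambda>x. 1) \<in> L2_space \<mu>"
      by (rule L2_space_bounded[where c=1]) (auto simp: assms(1))
    show "integrable \<mu> (\<lambda>x. \<bar>\<Phi> \<omega> x\<bar>)"
      using L2_mult_integrable[OF one L2[OF \<omega>]] by simp
    have "(\<lambda>m. if a m (Y \<omega>) \<le> x then 1 else 0 :: real) \<longlonglongrightarrow> (if Y \<omega> \<le> x then 1 else 0)" for x
    proof (cases "Y \<omega> \<le> x")
      case True
      then have "a m (Y \<omega>) \<le> x" for m
        using a_le[of m "Y \<omega>"] by linarith
      then show ?thesis
        using True by simp
    next
      case False
      then have "\<forall>\<^sub>F m in sequentially. x < a m (Y \<omega>)"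
        using order_tendstoD(1)[OF a_lim[of "Y \<omega>"], of x] by simp
      then have "\<forall>\<^sub>F m in sequentially. (if a m (Y \<omega>) \<le> x then 1 else 0 :: real) = 0"
        by eventually_elim simp
      then show ?thesis
        using False by (simp add: tendsto_eventually)
    qed
    then show "AE x in \<mu>. (\<lambda>m. (if a m (Y \<omega>) \<le> x then 1 else 0) * \<Phi> \<omega> x)
        \<longlonglongrightarrow> (if Y \<omega> \<le> x then 1 else 0) * \<Phi> \<omega> x"
      by (intro AE_I2 tendsto_mult tendsto_const)
  qed auto
  then show ?thesis
    by (rule borel_measurable_LIMSEQ_real[OF _ grid])
qed

section \<open>Random elements of the space of probability measures\<close>

lemma space_weak_borel: "space weak_borel = topspace weak_topology"
  by (auto simp: weak_borel_def intro!: space_measure_of dest: openin_subset)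

lemma sets_weak_borel: "openin weak_topology U \<Longrightarrow> U \<in> sets weak_borel"
  unfolding weak_borel_def by (subst sets_measure_of) (auto dest: openin_subset)

lemma space_weak_borel_real_distribution: "\<nu> \<in> space weak_borel \<Longrightarrow> real_distribution \<nu>"
  by (auto simp: space_weak_borel weak_topology_def topology_generated_by_topspace)

lemma integral_measurable_weak_borel:
  assumes "bcont f"
  shows "(\<lambda>\<nu>. \<integral>x. f x \<partial>\<nu>) \<in> borel_measurable weak_borel"
proof (rule borel_measurableI)
  fix S :: "real set" assume "open S"
  then have "openin weak_topology {\<nu>. real_distribution \<nu> \<and> (\<integral>x. f x \<partial>\<nu>) \<in> S}" (is "openin _ ?U")
    unfolding weak_topology_def using assms by (intro topology_generated_by_Basis) blast
  then have "?U \<in> sets weak_borel"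
    by (rule sets_weak_borel)
  moreover have "(\<lambda>\<nu>. \<integral>x. f x \<partial>\<nu>) -` S \<inter> space weak_borel = ?U"
    using sets.sets_into_space[OF calculation] space_weak_borel_real_distribution by auto
  ultimately show "(\<lambda>\<nu>. \<integral>x. f x \<partial>\<nu>) -` S \<inter> space weak_borel \<in> sets weak_borel"
    by simp
qed

lemma bcont_cts_step:
  assumes "a < b"
  shows "bcont (cts_step a b)"
proof -
  have "bounded (range (cts_step a b))"
    by (rule boundedI[of _ 1]) (use assms in \<open>auto simp: cts_step_def\<close>)
  then show ?thesis
    using cts_step_uniformly_continuous[OF assms]
    by (simp add: bcont_def uniformly_continuous_imp_continuous)
qed

text \<open>A distribution function is a pointwise limit of integrals of bounded continuous functions.\<close>

lemma cdf_lim_cts_step: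
  assumes "real_distribution \<nu>"
  shows "(\<lambda>m. \<integral>z. cts_step x (x + 1 / real (Suc m)) z \<partial>\<nu>) \<longlonglongrightarrow> cdf \<nu> x"
proof -
  interpret real_distribution \<nu> by fact
  have "((\<lambda>y. cdf \<nu> y) \<longlongrightarrow> cdf \<nu> x) (at_right x)"
    using cdf_is_right_cont[of x] by (simp add: continuous_within)
  moreover have "filterlim (\<lambda>m. x + 1 / real (Suc m)) (at_right x) sequentially"
  proof -
    have "(\<lambda>m. x + 1 / real (Suc m)) \<longlonglongrightarrow> x + 0"
      by (intro tendsto_add tendsto_const LIMSEQ_Suc lim_1_over_n)
    then show ?thesis
      by (simp add: filterlim_at del: of_nat_Suc)
  qed
  ultimately have "(\<lambda>m. cdf \<nu> (x + 1 / real (Suc m))) \<longlonglongrightarrow> cdf \<nu> x"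
    by (rule filterlim_compose)
  then show ?thesis
    by (rule tendsto_sandwich[of "\<lambda>_. cdf \<nu> x", rotated 3])
      (auto intro!: always_eventually cdf_cts_step simp del: of_nat_Suc)
qed

text \<open>Hence a probability measure is determined by its integrals of bounded continuous functions,
  which makes the barycenter unique.\<close>

lemma bcont_integrals_eq_imp_eq:
  assumes "real_distribution \<nu>" "real_distribution \<nu>'"
    and "\<And>f. bcont f \<Longrightarrow> (\<integral>x. f x \<partial>\<nu>) = (\<integral>x. f x \<partial>\<nu>')"
  shows "\<nu> = \<nu>'"
proof (rule cdf_unique[OF assms(1,2)], rule ext)
  fix x
  have "(\<lambda>m. \<integral>z. cts_step x (x + 1 / real (Suc m)) z \<partial>\<nu>) \<longlonglongrightarrow> cdf \<nu>' x"
    using cdf_lim_cts_step[OF assms(2), of x]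
    by (simp add: assms(3) bcont_cts_step del: of_nat_Suc)
  then show "cdf \<nu> x = cdf \<nu>' x"
    using cdf_lim_cts_step[OF assms(1), of x] LIMSEQ_unique by blast
qed

text \<open>A random element of the space of probability measures is a Markov kernel: half lines
  generate the Borel sets, and the distribution functions at fixed points are random variables.\<close>

lemma weak_borel_measurable_imp_kernel:
  assumes \<zeta>: "\<zeta> \<in> measurable N weak_borel"
  shows "\<zeta> \<in> measurable N (prob_algebra borel)"
proof (rule measurable_prob_algebra_generated[where G="range (\<lambda>x::real. {..x})" and \<Omega>=UNIV])
  have rd: "real_distribution (\<zeta> \<omega>)" if "\<omega> \<in> space N" for \<omega>
    using measurable_space[OF \<zeta> that] by (rule space_weak_borel_real_distribution)
  show "sets borel = sigma_sets UNIV (range (\<lambda>x::real. {..x}))"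
    by (subst borel_eq_atMost) simp
  show "Int_stable (range (\<lambda>x::real. {..x}))"
    by (auto simp: Int_stable_def)
  show "prob_space (\<zeta> \<omega>)" "sets (\<zeta> \<omega>) = sets borel" if "\<omega> \<in> space N" for \<omega>
    using rd[OF that] by (simp_all add: real_distribution_def real_distribution.events_eq_borel)
  fix A assume "A \<in> range (\<lambda>x::real. {..x})"
  then obtain x where A: "A = {..x}" by auto
  have "(\<lambda>\<omega>. cdf (\<zeta> \<omega>) x) \<in> borel_measurable N"
  proof (rule borel_measurable_LIMSEQ_real)
    show "(\<lambda>m. \<integral>z. cts_step x (x + 1 / real (Suc m)) z \<partial>\<zeta> \<omega>) \<longlonglongrightarrow> cdf (\<zeta> \<omega>) x"
      if "\<omega> \<in> space N" for \<omega>
      by (rule cdf_lim_cts_step[OF rd[OF that]])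
    show "(\<lambda>\<omega>. \<integral>z. cts_step x (x + 1 / real (Suc m)) z \<partial>\<zeta> \<omega>) \<in> borel_measurable N" for m
      by (intro measurable_compose[OF \<zeta>] integral_measurable_weak_borel bcont_cts_step)
        (simp del: of_nat_Suc)
  qed
  then have "(\<lambda>\<omega>. ennreal (cdf (\<zeta> \<omega>) x)) \<in> borel_measurable N"
    by measurable
  moreover have "emeasure (\<zeta> \<omega>) A = ennreal (cdf (\<zeta> \<omega>) x)" if "\<omega> \<in> space N" for \<omega>
    using rd[OF that] by (simp add: A cdf_def real_distribution_def finite_measure.emeasure_eq_measure prob_space_def)
  ultimately show "(\<lambda>\<omega>. emeasure (\<zeta> \<omega>) A) \<in> borel_measurable N"
    by (simp cong: measurable_cong)
qed simp

lemma cdf_jointly_measurable: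
  assumes "\<zeta> \<in> measurable N weak_borel" and sets_\<mu>: "sets \<mu> = sets borel"
  shows "(\<lambda>(\<omega>, x). cdf (\<zeta> \<omega>) x) \<in> borel_measurable (N \<Otimes>\<^sub>M \<mu>)"
proof -
  note [measurable] = measurable_prob_algebraD[OF weak_borel_measurable_imp_kernel[OF assms(1)]]
  have [measurable_cong]: "sets \<mu> = sets borel" by fact
  have "(SIGMA p:space (N \<Otimes>\<^sub>M \<mu>). {..snd p}) = {p \<in> space ((N \<Otimes>\<^sub>M \<mu>) \<Otimes>\<^sub>M (borel :: real measure)). snd p \<le> snd (fst p)}"
    by (auto simp: space_pair_measure)
  also have "\<dots> \<in> sets ((N \<Otimes>\<^sub>M \<mu>) \<Otimes>\<^sub>M borel)"
    by measurable
  finally have "(\<lambda>p. measure (\<zeta> (fst p)) {..snd p}) \<in> borel_measurable (N \<Otimes>\<^sub>M \<mu>)"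
    by (rule measure_measurable_subprob_algebra2) measurable
  then show ?thesis
    by (simp add: cdf_def case_prod_unfold)
qed

lemma cdf_measurable_at:
  assumes "\<zeta> \<in> measurable N weak_borel"
  shows "(\<lambda>\<omega>. cdf (\<zeta> \<omega>) x) \<in> borel_measurable N"
  using measurable_Pair2'[of x borel N] cdf_jointly_measurable[OF assms, of borel]
  by (auto dest: measurable_compose)

text \<open>The barycenter is the mixture of the random measure over the probability space.  Since it
  is defined by a definite description, its existence has to be shown for \<open>mean_cdf\<close> to be the
  distribution function of a probability measure.\<close>

lemma barycenter_real_distribution:
  assumes "prob_space M" and \<zeta>: "\<zeta> \<in> measurable M weak_borel"
  shows "real_distribution (barycenter M \<zeta>)"
proof -
  interpret prob_space M by fact
  note K = weak_borel_measurable_imp_kernel[OF \<zeta>]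
  note K' = measurable_prob_algebraD[OF K]
  define \<nu> where "\<nu> = M \<bind> \<zeta>"
  have M: "M \<in> space (prob_algebra M)"
    by (simp add: space_prob_algebra prob_space_axioms)
  have \<nu>: "real_distribution \<nu>"
    using prob_space_bind'[OF M K] sets_bind'[OF M K]
    by (simp add: real_distribution_def real_distribution_axioms_def \<nu>_def)
  have eq: "(\<integral>\<omega>. (\<integral>x. f x \<partial>\<zeta> \<omega>) \<partial>M) = (\<integral>x. f x \<partial>\<nu>)" if f: "bcont f" for f
  proof -
    obtain B where "\<And>x. \<bar>f x\<bar> \<le> B"
      using f by (auto simp: bcont_def bounded_iff)
    then show ?thesis
      unfolding \<nu>_def using f
      by (subst integral_bind[OF _ _ K' finite_measure_axioms, where B=B and B'=1])
        (auto simp: bcont_def borel_measurable_continuous_onI space_subprob_algebra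
          intro!: AE_I2 subprob_space.emeasure_space_le_1 dest!: measurable_space[OF K'])
  qed
  have "barycenter M \<zeta> = \<nu>"
    unfolding barycenter_def
    by (rule the_equality) (use \<nu> eq in \<open>auto intro!: bcont_integrals_eq_imp_eq\<close>)
  then show ?thesis
    using \<nu> by simp
qed

section \<open>Conditionally centred random variables\<close>

context finite_measure_subalgebra
begin

lemma cond_mean_zero_set_integral:
  assumes "cond_mean_zero M F Y" "A \<in> sets F"
  shows "(\<integral>\<omega>\<in>A. Y \<omega> \<partial>M) = 0"
proof -
  have A: "A \<in> sets M"
    using assms(2) subalg by (auto simp: subalgebra_def)
  have "(\<integral>\<omega>\<in>A. Y \<omega> \<partial>M) = (\<integral>\<omega>\<in>A. real_cond_exp M F Y \<omega> \<partial>M)"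
    using assms by (intro real_cond_exp_intA) (auto simp: cond_mean_zero_def)
  also have "\<dots> = (\<integral>\<omega>\<in>A. 0 \<partial>M)"
    using assms(1) A by (intro set_lebesgue_integral_cong_AE) (auto simp: cond_mean_zero_def)
  finally show ?thesis
    by simp
qed

lemma cond_mean_zeroI:
  assumes "integrable M Y" "\<And>A. A \<in> sets F \<Longrightarrow> (\<integral>\<omega>\<in>A. Y \<omega> \<partial>M) = 0"
  shows "cond_mean_zero M F Y"
  unfolding cond_mean_zero_def using assms by (intro conjI real_cond_exp_charact) auto

lemma cond_mean_zero_cong:
  assumes "\<And>\<omega>. \<omega> \<in> space M \<Longrightarrow> Y \<omega> = Z \<omega>" "cond_mean_zero M F Z"
  shows "cond_mean_zero M F Y"
proof (rule cond_mean_zeroI)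
  have Z: "integrable M Z"
    using assms(2) by (simp add: cond_mean_zero_def)
  show "integrable M Y"
    using Z Bochner_Integration.integrable_cong[of M M Y Z] assms(1) by simp
  fix A assume A: "A \<in> sets F"
  have "(\<integral>\<omega>\<in>A. Y \<omega> \<partial>M) = (\<integral>\<omega>\<in>A. Z \<omega> \<partial>M)"
    unfolding set_lebesgue_integral_def
    by (intro Bochner_Integration.integral_cong) (auto simp: assms(1))
  then show "(\<integral>\<omega>\<in>A. Y \<omega> \<partial>M) = 0"
    using cond_mean_zero_set_integral[OF assms(2) A] by simp
qed

lemma cond_mean_zero_diff:
  assumes "cond_mean_zero M F Y" "cond_mean_zero M F Z"
  shows "cond_mean_zero M F (\<lambda>\<omega>. Y \<omega> - Z \<omega>)"
proof -
  have int: "integrable M Y" "integrable M Z"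
    using assms by (simp_all add: cond_mean_zero_def)
  have "AE \<omega> in M. real_cond_exp M F Y \<omega> = 0" "AE \<omega> in M. real_cond_exp M F Z \<omega> = 0"
    using assms by (simp_all add: cond_mean_zero_def)
  with real_cond_exp_diff[OF int] have "AE \<omega> in M. real_cond_exp M F (\<lambda>\<omega>. Y \<omega> - Z \<omega>) \<omega> = 0"
    by eventually_elim simp
  then show ?thesis
    using int by (simp add: cond_mean_zero_def)
qed

lemma cond_mean_zero_sum:
  assumes "\<And>i. i \<in> I \<Longrightarrow> cond_mean_zero M F (Y i)"
  shows "cond_mean_zero M F (\<lambda>\<omega>. \<Sum>i\<in>I. Y i \<omega>)"
proof (rule cond_mean_zeroI)
  have int: "integrable M (Y i)" if "i \<in> I" for i
    using assms[OF that] by (simp add: cond_mean_zero_def)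
  then show "integrable M (\<lambda>\<omega>. \<Sum>i\<in>I. Y i \<omega>)"
    by simp
  fix A assume A: "A \<in> sets F"
  then have "A \<in> sets M"
    using subalg by (auto simp: subalgebra_def)
  then have "(\<integral>\<omega>\<in>A. (\<Sum>i\<in>I. Y i \<omega>) \<partial>M) = (\<Sum>i\<in>I. (\<integral>\<omega>\<in>A. Y i \<omega> \<partial>M))"
    using int integrable_mult_indicator[of A M "Y _"]
    by (simp add: set_lebesgue_integral_def sum_distrib_left)
  then show "(\<integral>\<omega>\<in>A. (\<Sum>i\<in>I. Y i \<omega>) \<partial>M) = 0"
    using assms A by (simp add: cond_mean_zero_set_integral)
qed

lemma cond_mean_zero_mult:
  assumes Z: "Z \<in> borel_measurable F" "\<And>\<omega>. \<omega> \<in> space M \<Longrightarrow> \<bar>Z \<omega>\<bar> \<le> c"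
    and Y: "cond_mean_zero M F Y"
  shows "cond_mean_zero M F (\<lambda>\<omega>. Z \<omega> * Y \<omega>)"
proof -
  have [measurable]: "Z \<in> borel_measurable M" "Y \<in> borel_measurable M"
    using Y measurable_from_subalg[OF subalg Z(1)] by (auto simp: cond_mean_zero_def)
  have "integrable M (\<lambda>\<omega>. Z \<omega> * Y \<omega>)"
  proof (rule Bochner_Integration.integrable_bound)
    show "integrable M (\<lambda>\<omega>. c * Y \<omega>)"
      using Y by (simp add: cond_mean_zero_def)
    show "AE \<omega> in M. norm (Z \<omega> * Y \<omega>) \<le> norm (c * Y \<omega>)"
      using Z(2) by (intro AE_I2) (force simp: abs_mult intro!: mult_right_mono)
  qed measurable
  then show ?thesis
    using Y real_cond_exp_mult[OF Z(1), of Y] by (auto simp: cond_mean_zero_def)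
qed

lemma cond_mean_zero_cmult:
  assumes "cond_mean_zero M F Y"
  shows "cond_mean_zero M F (\<lambda>\<omega>. c * Y \<omega>)"
  using assms by (intro cond_mean_zero_mult[where c="\<bar>c\<bar>"]) auto

lemma cond_mean_zero_minus_cond_exp:
  assumes "integrable M Y" "integrable M Z" "Z \<in> borel_measurable F"
    and "AE \<omega> in M. real_cond_exp M F Y \<omega> = Z \<omega>"
  shows "cond_mean_zero M F (\<lambda>\<omega>. Y \<omega> - Z \<omega>)"
proof -
  have "AE \<omega> in M. real_cond_exp M F (\<lambda>\<omega>. Y \<omega> - Z \<omega>) \<omega> = 0"
    using real_cond_exp_diff[OF assms(1,2)] real_cond_exp_F_meas[OF assms(2,3)] assms(4)
    by eventually_elim simp
  then show ?thesis
    using assms(1,2) by (simp add: cond_mean_zero_def)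
qed

text \<open>Conditional centring passes through an integral over a parameter, by Fubini's theorem
  applied on each event of the sub-\<open>\<sigma>\<close>-algebra.\<close>

lemma cond_mean_zero_integral:
  assumes \<mu>: "finite_measure \<mu>"
    and [measurable]: "(\<lambda>(\<omega>, x). H \<omega> x) \<in> borel_measurable (M \<Otimes>\<^sub>M \<mu>)"
    and bound: "\<And>\<omega> x. \<omega> \<in> space M \<Longrightarrow> \<bar>H \<omega> x\<bar> \<le> c"
    and g: "integrable \<mu> g"
    and zero: "\<And>x. cond_mean_zero M F (\<lambda>\<omega>. H \<omega> x)"
  shows "cond_mean_zero M F (\<lambda>\<omega>. \<integral>x. H \<omega> x * g x \<partial>\<mu>)"
proof -
  interpret \<mu>: finite_measure \<mu> by fact
  interpret P: pair_sigma_finite M \<mu> ..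
  have [measurable]: "g \<in> borel_measurable \<mu>"
    using g by simp
  have "integrable (M \<Otimes>\<^sub>M \<mu>) (\<lambda>(\<omega>, x). c * g x)"
  proof (rule P.Fubini_integrable)
    show "integrable M (\<lambda>\<omega>. \<integral>x. norm (case (\<omega>, x) of (\<omega>, x) \<Rightarrow> c * g x) \<partial>\<mu>)"
      by simp
  qed (use g in auto)
  then have int: "integrable (M \<Otimes>\<^sub>M \<mu>) (\<lambda>(\<omega>, x). H \<omega> x * g x)"
  proof (rule Bochner_Integration.integrable_bound)
    show "AE p in M \<Otimes>\<^sub>M \<mu>. norm (case p of (\<omega>, x) \<Rightarrow> H \<omega> x * g x) \<le> norm (case p of (\<omega>, x) \<Rightarrow> c * g x)"
    proof (rule AE_I2)
      fix p assume "p \<in> space (M \<Otimes>\<^sub>M \<mu>)"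
      then have "\<bar>H (fst p) (snd p)\<bar> \<le> \<bar>c\<bar>"
        using bound[of "fst p" "snd p"] by (auto simp: space_pair_measure)
      then show "norm (case p of (\<omega>, x) \<Rightarrow> H \<omega> x * g x) \<le> norm (case p of (\<omega>, x) \<Rightarrow> c * g x)"
        by (simp add: case_prod_unfold abs_mult mult_right_mono)
    qed
  qed measurable
  show ?thesis
  proof (rule cond_mean_zeroI)
    show "integrable M (\<lambda>\<omega>. \<integral>x. H \<omega> x * g x \<partial>\<mu>)"
      using P.integrable_fst[OF int] by simp
    fix A assume A: "A \<in> sets F"
    then have [measurable]: "A \<in> sets M"
      using subalg by (auto simp: subalgebra_def)
    have int_A: "integrable (M \<Otimes>\<^sub>M \<mu>) (\<lambda>(\<omega>, x). indicator A \<omega> * (H \<omega> x * g x))"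
      by (rule Bochner_Integration.integrable_bound[OF int]) (auto split: split_indicator)
    have "(\<integral>\<omega>\<in>A. (\<integral>x. H \<omega> x * g x \<partial>\<mu>) \<partial>M) = (\<integral>\<omega>. (\<integral>x. indicator A \<omega> * (H \<omega> x * g x) \<partial>\<mu>) \<partial>M)"
      by (simp add: set_lebesgue_integral_def)
    also have "\<dots> = (\<integral>x. (\<integral>\<omega>. indicator A \<omega> * (H \<omega> x * g x) \<partial>M) \<partial>\<mu>)"
      by (rule P.Fubini_integral[OF int_A, symmetric])
    also have "\<dots> = (\<integral>x. (\<integral>\<omega>\<in>A. H \<omega> x \<partial>M) * g x \<partial>\<mu>)"
      by (simp add: set_lebesgue_integral_def flip: mult.assoc)
    also have "\<dots> = 0"
      by (simp add: cond_mean_zero_set_integral[OF zero A])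
    finally show "(\<integral>\<omega>\<in>A. (\<integral>x. H \<omega> x * g x \<partial>\<mu>) \<partial>M) = 0" .
  qed
qed

end

section \<open>Sampling errors of a conjugate process\<close>

lemma space_Xi_alg: "space (Xi_alg M \<xi>) = space M"
  unfolding Xi_alg_def by (rule space_measure_of) auto

lemma measurable_Xi_alg:
  assumes "\<xi> t \<in> measurable M weak_borel"
  shows "\<xi> t \<in> measurable (Xi_alg M \<xi>) weak_borel"
proof (rule measurableI)
  show "\<xi> t \<omega> \<in> space weak_borel" if "\<omega> \<in> space (Xi_alg M \<xi>)" for \<omega>
    using assms that by (auto simp: space_Xi_alg dest: measurable_space)
  show "\<xi> t -` A \<inter> space (Xi_alg M \<xi>) \<in> sets (Xi_alg M \<xi>)" if "A \<in> sets weak_borel" for A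
    using that unfolding space_Xi_alg unfolding Xi_alg_def by (subst sets_measure_of) auto
qed

lemma subalgebra_Xi_alg:
  assumes "\<And>t. \<xi> t \<in> measurable M weak_borel"
  shows "subalgebra M (Xi_alg M \<xi>)"
  unfolding subalgebra_def space_Xi_alg
  using assms unfolding Xi_alg_def
  by (subst sets_measure_of) (auto intro!: sets.sigma_sets_subset)

lemma cdf_bounds:
  assumes "real_distribution \<nu>"
  shows "0 \<le> cdf \<nu> x" "cdf \<nu> x \<le> 1"
  using assms real_distribution.cdf_bounded_prob
  by (auto simp: cdf_def)

lemma cdf_borel_measurable:
  assumes "real_distribution \<nu>"
  shows "cdf \<nu> \<in> borel_measurable borel"
proof (rule borel_measurable_mono)
  interpret real_distribution \<nu> by fact
  show "mono (cdf \<nu>)"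
    by (auto simp: mono_def intro: cdf_nondecreasing)
qed

lemma cycle_alg_vimage:
  assumes "\<tau> \<in> {real t..<real t + 1}" "B \<in> sets borel"
  shows "X \<tau> -` B \<inter> space M \<in> sets (cycle_alg M X t)"
  unfolding cycle_alg_def using assms by (subst sets_measure_of) (blast intro: sigma_sets.Basic)+

text \<open>The error made at the point \<open>x\<close> when \<open>\<xi> t\<close> is estimated by the point mass at the
  single observation \<open>X \<tau>\<close>.\<close>

definition obs_error ::
  "(nat \<Rightarrow> 'a \<Rightarrow> real measure) \<Rightarrow> (real \<Rightarrow> 'a \<Rightarrow> real) \<Rightarrow> nat \<Rightarrow> real \<Rightarrow> 'a \<Rightarrow> real \<Rightarrow> real" where
  "obs_error \<xi> X t \<tau> \<omega> x = (if X \<tau> \<omega> \<le> x then 1 else 0) - cdf (\<xi> t \<omega>) x"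

lemma eps_eq_mean_obs_error:
  assumes "sampling_scheme q s"
  shows "eps \<xi> X q s t \<omega> x = (1 / real (q t)) * (\<Sum>i=1..q t. obs_error \<xi> X t (s t i) \<omega> x)"
proof -
  have "q t \<noteq> 0"
    using assms by (metis sampling_scheme_def not_one_le_zero)
  then show ?thesis
    by (simp add: eps_def F_hat_def obs_error_def sum_subtractf field_simps)
qed

text \<open>A cyclic-independent conjugate process of a sequence \<open>\<xi>\<close> of random probability
  measures.\<close>

locale sampled_process = prob_space M
  for M :: "'a measure" and \<xi> :: "nat \<Rightarrow> 'a \<Rightarrow> real measure" and X :: "real \<Rightarrow> 'a \<Rightarrow> real" +
  assumes xi_measurable: "\<xi> t \<in> measurable M weak_borel"
    and conj: "conjugate_process M \<xi> X"
    and indep: "cyclic_independent M \<xi> X"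
begin

sublocale finite_measure_subalgebra M "Xi_alg M \<xi>"
  by unfold_locales (rule subalgebra_Xi_alg[OF xi_measurable])

lemma xi_real_distribution: "\<omega> \<in> space M \<Longrightarrow> real_distribution (\<xi> t \<omega>)"
  using measurable_space[OF xi_measurable] by (rule space_weak_borel_real_distribution)

lemma cdf_xi_bound: "\<omega> \<in> space M \<Longrightarrow> \<bar>cdf (\<xi> t \<omega>) x\<bar> \<le> 1"
  using cdf_bounds[OF xi_real_distribution, of \<omega> t x] by simp

lemma cdf_xi_Xi_measurable: "(\<lambda>\<omega>. cdf (\<xi> t \<omega>) x) \<in> borel_measurable (Xi_alg M \<xi>)"
  by (rule cdf_measurable_at[OF measurable_Xi_alg[OF xi_measurable]])

lemma cdf_xi_measurable [measurable]: "(\<lambda>\<omega>. cdf (\<xi> t \<omega>) x) \<in> borel_measurable M"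
  by (rule cdf_measurable_at[OF xi_measurable])

lemma cycle_time_measurable:
  assumes "\<tau> \<in> {real t..<real t + 1}"
  shows "X \<tau> \<in> borel_measurable M"
proof -
  have "0 \<le> \<tau>"
    using assms by (auto intro: order_trans[of 0 "real t"])
  then show ?thesis
    using conj by (simp add: conjugate_process_def)
qed

lemma cond_exp_obs:
  assumes "\<tau> \<in> {real t..<real t + 1}"
  shows "AE \<omega> in M. real_cond_exp M (Xi_alg M \<xi>) (indicator (X \<tau> -` {..x} \<inter> space M)) \<omega> = cdf (\<xi> t \<omega>) x"
  using conj assms unfolding conjugate_process_def cdf_def by auto

lemma cond_mean_zero_obs_error:
  assumes \<tau>: "\<tau> \<in> {real t..<real t + 1}"
  shows "cond_mean_zero M (Xi_alg M \<xi>) (\<lambda>\<omega>. obs_error \<xi> X t \<tau> \<omega> x)"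
proof -
  note [measurable] = cycle_time_measurable[OF \<tau>]
  have "cond_mean_zero M (Xi_alg M \<xi>)
      (\<lambda>\<omega>. indicator (X \<tau> -` {..x} \<inter> space M) \<omega> - cdf (\<xi> t \<omega>) x)"
    by (intro cond_mean_zero_minus_cond_exp cdf_xi_Xi_measurable cond_exp_obs[OF \<tau>]
        integrable_const_bound[where B=1] AE_I2) (auto simp: cdf_xi_bound)
  then show ?thesis
    by (rule cond_mean_zero_cong[rotated]) (auto simp: obs_error_def)
qed

text \<open>With \<open>A\<close>, \<open>B\<close> the two observed events and \<open>f\<close>, \<open>g\<close> their conditional probabilities,
  \<open>(1\<^sub>A - f) (1\<^sub>B - g) = (1\<^sub>A\<^sub>\<inter>\<^sub>B - f g) - f (1\<^sub>B - g) - g (1\<^sub>A - f)\<close>; the first term on the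
  right is centred by cyclic independence, the others because \<open>f\<close> and \<open>g\<close> are known given \<open>\<Xi>\<close>.\<close>

lemma cond_mean_zero_obs_error_mult:
  assumes "t \<noteq> r" and \<tau>: "\<tau> \<in> {real t..<real t + 1}" and \<sigma>: "\<sigma> \<in> {real r..<real r + 1}"
  shows "cond_mean_zero M (Xi_alg M \<xi>) (\<lambda>\<omega>. obs_error \<xi> X t \<tau> \<omega> x * obs_error \<xi> X r \<sigma> \<omega> y)"
proof -
  note [measurable] = cycle_time_measurable[OF \<tau>] cycle_time_measurable[OF \<sigma>]
  note [measurable] = cdf_xi_Xi_measurable
  define A where "A = X \<tau> -` {..x} \<inter> space M"
  define B where "B = X \<sigma> -` {..y} \<inter> space M"
  let ?f = "\<lambda>\<omega>. cdf (\<xi> t \<omega>) x" and ?g = "\<lambda>\<omega>. cdf (\<xi> r \<omega>) y"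
  define E where "E u = (if u = t then A else B)" for u
  have E: "\<forall>u\<in>{t, r}. E u \<in> sets (cycle_alg M X u)"
    using cycle_alg_vimage[OF \<tau>, of "{..x}" X M] cycle_alg_vimage[OF \<sigma>, of "{..y}" X M] assms(1)
    by (auto simp: E_def A_def B_def)
  have "AE \<omega> in M. real_cond_exp M (Xi_alg M \<xi>) (indicator (\<Inter>u\<in>{t, r}. E u)) \<omega>
      = (\<Prod>u\<in>{t, r}. real_cond_exp M (Xi_alg M \<xi>) (indicator (E u)) \<omega>)"
    using indep[unfolded cyclic_independent_def, rule_format, of "{t, r}" E] E by blast
  moreover have "(\<Inter>u\<in>{t, r}. E u) = A \<inter> B"
    using assms(1) by (auto simp: E_def)
  ultimately have AB: "AE \<omega> in M. real_cond_exp M (Xi_alg M \<xi>) (indicator (A \<inter> B)) \<omega> = ?f \<omega> * ?g \<omega>"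
    using cond_exp_obs[OF \<tau>, of x] cond_exp_obs[OF \<sigma>, of y] assms(1)
    by (auto simp: E_def A_def B_def)
  have bound: "\<bar>?f \<omega> * ?g \<omega>\<bar> \<le> 1" if "\<omega> \<in> space M" for \<omega>
    using mult_mono[OF cdf_xi_bound[OF that, of t x] cdf_xi_bound[OF that, of r y]] by (simp add: abs_mult)
  have "cond_mean_zero M (Xi_alg M \<xi>) (\<lambda>\<omega>. indicator (A \<inter> B) \<omega> - ?f \<omega> * ?g \<omega>)"
  proof (rule cond_mean_zero_minus_cond_exp[OF _ _ _ AB])
    show "integrable M (indicator (A \<inter> B) :: 'a \<Rightarrow> real)" "integrable M (\<lambda>\<omega>. ?f \<omega> * ?g \<omega>)"
      by (intro integrable_const_bound[where B=1] AE_I2; auto simp: A_def B_def bound)+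
  qed measurable
  moreover have "cond_mean_zero M (Xi_alg M \<xi>) (\<lambda>\<omega>. ?f \<omega> * obs_error \<xi> X r \<sigma> \<omega> y)"
    by (intro cond_mean_zero_mult[where c=1] cond_mean_zero_obs_error \<sigma>) (auto simp: cdf_xi_bound)
  moreover have "cond_mean_zero M (Xi_alg M \<xi>) (\<lambda>\<omega>. ?g \<omega> * obs_error \<xi> X t \<tau> \<omega> x)"
    by (intro cond_mean_zero_mult[where c=1] cond_mean_zero_obs_error \<tau>) (auto simp: cdf_xi_bound)
  ultimately have "cond_mean_zero M (Xi_alg M \<xi>) (\<lambda>\<omega>. indicator (A \<inter> B) \<omega> - ?f \<omega> * ?g \<omega>
      - ?f \<omega> * obs_error \<xi> X r \<sigma> \<omega> y - ?g \<omega> * obs_error \<xi> X t \<tau> \<omega> x)"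
    by (rule cond_mean_zero_diff[OF cond_mean_zero_diff])
  then show ?thesis
  proof (rule cond_mean_zero_cong[rotated])
    fix \<omega> assume "\<omega> \<in> space M"
    then have ind: "indicator (A \<inter> B) \<omega> = (if X \<tau> \<omega> \<le> x then 1 else 0) * (if X \<sigma> \<omega> \<le> y then 1 else 0 :: real)"
      by (simp add: A_def B_def)
    have "(a - f) * (b - g) = a * b - f * g - f * (b - g) - g * (a - f)" for a b f g :: real
      by (simp add: algebra_simps)
    then show "obs_error \<xi> X t \<tau> \<omega> x * obs_error \<xi> X r \<sigma> \<omega> y = indicator (A \<inter> B) \<omega> - ?f \<omega> * ?g \<omega>
        - ?f \<omega> * obs_error \<xi> X r \<sigma> \<omega> y - ?g \<omega> * obs_error \<xi> X t \<tau> \<omega> x"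
      unfolding obs_error_def ind .
  qed
qed

context
  fixes q :: "nat \<Rightarrow> nat" and s :: "nat \<Rightarrow> nat \<Rightarrow> real"
  assumes sampling: "sampling_scheme q s"
begin

lemma sample_time: "i \<in> {1..q t} \<Longrightarrow> s t i \<in> {real t..<real t + 1}"
  using sampling by (simp add: sampling_scheme_def)

lemma sample_measurable: "i \<in> {1..q t} \<Longrightarrow> X (s t i) \<in> borel_measurable M"
  by (rule cycle_time_measurable[OF sample_time])

lemma F_hat_bounds: "0 \<le> F_hat X q s t \<omega> x" "F_hat X q s t \<omega> x \<le> 1"
proof -
  have "(\<Sum>i=1..q t. if X (s t i) \<omega> \<le> x then 1 else 0 :: real) \<le> (\<Sum>i=1..q t. 1)"
    by (rule sum_mono) simp
  then show "F_hat X q s t \<omega> x \<le> 1"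
    by (simp add: F_hat_def divide_le_eq)
  show "0 \<le> F_hat X q s t \<omega> x"
    by (simp add: F_hat_def sum_nonneg)
qed

lemma eps_bound: "\<omega> \<in> space M \<Longrightarrow> \<bar>eps \<xi> X q s t \<omega> x\<bar> \<le> 1"
  using F_hat_bounds[of t \<omega> x] cdf_bounds[OF xi_real_distribution, of \<omega> t x]
  unfolding eps_def by linarith

lemma eps_jointly_measurable:
  assumes "sets \<mu> = sets borel"
  shows "(\<lambda>(\<omega>, x). eps \<xi> X q s t \<omega> x) \<in> borel_measurable (M \<Otimes>\<^sub>M \<mu>)"
proof -
  have [measurable_cong]: "sets \<mu> = sets borel" by fact
  note [measurable] = cdf_jointly_measurable[OF xi_measurable assms]
  have "(\<lambda>p. if X (s t i) (fst p) \<le> snd p then 1 else 0 :: real) \<in> borel_measurable (M \<Otimes>\<^sub>M \<mu>)"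
    if "i \<in> {1..q t}" for i
  proof -
    note [measurable] = sample_measurable[OF that]
    show ?thesis by measurable
  qed
  then have "(\<lambda>p. (1 / real (q t)) * (\<Sum>i=1..q t. if X (s t i) (fst p) \<le> snd p then 1 else 0)
      - (case p of (\<omega>, x) \<Rightarrow> cdf (\<xi> t \<omega>) x)) \<in> borel_measurable (M \<Otimes>\<^sub>M \<mu>)"
    by (intro borel_measurable_diff borel_measurable_times borel_measurable_sum
        borel_measurable_const cdf_jointly_measurable[OF xi_measurable assms])
  then show ?thesis
    by (simp add: eps_def F_hat_def case_prod_unfold)
qed

lemma cond_mean_zero_eps: "cond_mean_zero M (Xi_alg M \<xi>) (\<lambda>\<omega>. eps \<xi> X q s t \<omega> x)"
  unfolding eps_eq_mean_obs_error[OF sampling]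
  by (intro cond_mean_zero_cmult cond_mean_zero_sum cond_mean_zero_obs_error sample_time)

lemma cond_mean_zero_eps_mult:
  assumes "t \<noteq> r"
  shows "cond_mean_zero M (Xi_alg M \<xi>) (\<lambda>\<omega>. eps \<xi> X q s t \<omega> x * eps \<xi> X q s r \<omega> y)"
proof -
  have "cond_mean_zero M (Xi_alg M \<xi>) (\<lambda>\<omega>. (1 / real (q t) * (1 / real (q r))) *
      (\<Sum>i=1..q t. \<Sum>k=1..q r. obs_error \<xi> X t (s t i) \<omega> x * obs_error \<xi> X r (s r k) \<omega> y))"
    by (intro cond_mean_zero_cmult cond_mean_zero_sum cond_mean_zero_obs_error_mult assms sample_time)
  then show ?thesis
    unfolding eps_eq_mean_obs_error[OF sampling] by (simp add: sum_product)
qed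

end

end

section \<open>Innovations\<close>

lemma mean_cdf_properties:
  assumes "prob_space M" "\<xi> 0 \<in> measurable M weak_borel"
  shows "mean_cdf M \<xi> \<in> borel_measurable borel" "0 \<le> mean_cdf M \<xi> x" "mean_cdf M \<xi> x \<le> 1"
proof -
  note rd = barycenter_real_distribution[OF assms]
  show "mean_cdf M \<xi> \<in> borel_measurable borel"
    unfolding mean_cdf_def[abs_def] by (rule cdf_borel_measurable[OF rd])
  show "0 \<le> mean_cdf M \<xi> x" "mean_cdf M \<xi> x \<le> 1"
    using cdf_bounds[OF rd] by (simp_all add: mean_cdf_def)
qed

text \<open>A sampled conjugate process with a finite Borel measure \<open>\<mu>\<close> and deterministic unit vectors
  \<open>\<psi> j\<close> of \<open>L\<^sup>2(\<mu>)\<close>, in place of the eigenfunctions.\<close>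

locale sampled_L2_process = sampled_process M \<xi> X
  for M :: "'a measure" and \<xi> :: "nat \<Rightarrow> 'a \<Rightarrow> real measure" and X :: "real \<Rightarrow> 'a \<Rightarrow> real" +
  fixes \<mu> :: "real measure" and \<psi> :: "nat \<Rightarrow> real \<Rightarrow> real"
    and q :: "nat \<Rightarrow> nat" and s :: "nat \<Rightarrow> nat \<Rightarrow> real"
  assumes finite_mu: "finite_measure \<mu>" and sets_mu: "sets \<mu> = sets borel"
    and psi_L2: "\<psi> j \<in> L2_space \<mu>" and psi_norm: "L2_norm \<mu> (\<psi> j) = 1"
    and sampling: "sampling_scheme q s"
begin

lemma space_mu: "space \<mu> = UNIV"
  using sets_eq_imp_space_eq[OF sets_mu] by simp

lemma psi_integrable: "integrable \<mu> (\<psi> j)"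
proof -
  have "(\<lambda>_. 1) \<in> L2_space \<mu>"
    by (rule L2_space_bounded[OF finite_mu, where c=1]) auto
  then show ?thesis
    using L2_mult_integrable[OF _ psi_L2[of j]] by fastforce
qed

lemma mean_cdf_measurable [measurable]: "mean_cdf M \<xi> \<in> borel_measurable borel"
  and mean_cdf_bounds: "0 \<le> mean_cdf M \<xi> x" "mean_cdf M \<xi> x \<le> 1"
  using mean_cdf_properties[OF prob_space_axioms xi_measurable] by auto

lemma L2_spaceI:
  assumes "f \<in> borel_measurable borel" "\<And>x. \<bar>f x\<bar> \<le> c"
  shows "f \<in> L2_space \<mu>"
  using assms by (intro L2_space_bounded[OF finite_mu]) (simp_all cong: measurable_cong_sets add: sets_mu)

lemma F_hat_measurable: "F_hat X q s t \<omega> \<in> borel_measurable borel"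
  unfolding F_hat_def[abs_def] by measurable

lemma F_hat_L2: "F_hat X q s t \<omega> \<in> L2_space \<mu>"
  using F_hat_bounds[OF sampling, of t \<omega>] by (intro L2_spaceI[where c=1] F_hat_measurable) (simp add: abs_le_iff)

lemma cdf_xi_L2:
  assumes "\<omega> \<in> space M"
  shows "cdf (\<xi> t \<omega>) \<in> L2_space \<mu>"
  by (intro L2_spaceI[where c=1] cdf_borel_measurable xi_real_distribution cdf_xi_bound assms)

lemma mean_cdf_L2: "mean_cdf M \<xi> \<in> L2_space \<mu>"
  using mean_cdf_bounds by (intro L2_spaceI[where c=1] mean_cdf_measurable) (simp add: abs_le_iff)

lemma mean_cdf_hat_bounds: "0 \<le> mean_cdf_hat X q s n \<omega> x" "mean_cdf_hat X q s n \<omega> x \<le> 1"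
proof -
  have "(\<Sum>t=1..n. F_hat X q s t \<omega> x) \<le> (\<Sum>t=1..n. 1)"
    by (rule sum_mono) (rule F_hat_bounds[OF sampling])
  then show "mean_cdf_hat X q s n \<omega> x \<le> 1"
    by (simp add: mean_cdf_hat_def divide_le_eq)
  show "0 \<le> mean_cdf_hat X q s n \<omega> x"
    by (simp add: mean_cdf_hat_def sum_nonneg F_hat_bounds[OF sampling])
qed

lemma mean_cdf_hat_measurable: "mean_cdf_hat X q s n \<omega> \<in> borel_measurable borel"
  unfolding mean_cdf_hat_def[abs_def] using F_hat_measurable by measurable

lemma mean_cdf_hat_L2: "mean_cdf_hat X q s n \<omega> \<in> L2_space \<mu>"
  using mean_cdf_hat_bounds by (intro L2_spaceI[where c=1] mean_cdf_hat_measurable) (simp add: abs_le_iff)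

lemma eps_L2: "\<omega> \<in> space M \<Longrightarrow> eps \<xi> X q s t \<omega> \<in> L2_space \<mu>"
  unfolding eps_def[abs_def] by (intro L2_space_diff F_hat_L2 cdf_xi_L2)

lemma innov_le_norm:
  assumes "\<omega> \<in> space M"
  shows "\<bar>innov \<xi> X q s \<mu> \<psi> t j \<omega>\<bar> \<le> L2_norm \<mu> (eps \<xi> X q s t \<omega>)"
  using L2_Cauchy_Schwarz[OF eps_L2[OF assms] psi_L2] by (simp add: innov_def psi_norm)

lemma innov_bound:
  assumes "\<omega> \<in> space M"
  shows "\<bar>innov \<xi> X q s \<mu> \<psi> t j \<omega>\<bar> \<le> sqrt (measure \<mu> UNIV)"
  using innov_le_norm[OF assms, of t j]
    L2_norm_le_sqrt_measure[OF finite_mu L2_spaceD(1)[OF eps_L2[OF assms]] eps_bound[OF sampling assms]]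
  unfolding space_mu by (rule order_trans)

lemma innov_measurable [measurable]: "innov \<xi> X q s \<mu> \<psi> t j \<in> borel_measurable M"
proof -
  interpret \<mu>: finite_measure \<mu> by (rule finite_mu)
  note [measurable] = eps_jointly_measurable[OF sampling sets_mu] L2_spaceD(1)[OF psi_L2]
  show ?thesis
    unfolding innov_def[abs_def] L2_inner_def by measurable
qed

lemma cond_mean_zero_innov: "cond_mean_zero M (Xi_alg M \<xi>) (innov \<xi> X q s \<mu> \<psi> t j)"
  unfolding innov_def[abs_def] L2_inner_def
  by (rule cond_mean_zero_integral[OF finite_mu eps_jointly_measurable[OF sampling sets_mu]
        eps_bound[OF sampling] psi_integrable cond_mean_zero_eps[OF sampling]])

text \<open>Both inner products are integrated out one after the other, the remaining factor being a
  bounded random variable; this reduces the claim to products of pointwise errors.\<close>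

lemma cond_mean_zero_innov_mult:
  assumes "t \<noteq> r"
  shows "cond_mean_zero M (Xi_alg M \<xi>)
    (\<lambda>\<omega>. innov \<xi> X q s \<mu> \<psi> t j \<omega> * innov \<xi> X q s \<mu> \<psi> r i \<omega>)"
proof -
  have [measurable_cong]: "sets \<mu> = sets borel" by (rule sets_mu)
  note [measurable] = eps_jointly_measurable[OF sampling sets_mu]
  have inner: "cond_mean_zero M (Xi_alg M \<xi>) (\<lambda>\<omega>. innov \<xi> X q s \<mu> \<psi> r i \<omega> * eps \<xi> X q s t \<omega> x)" for x
  proof -
    have "(\<lambda>\<omega>. eps \<xi> X q s t \<omega> x) \<in> borel_measurable M"
      using cond_mean_zero_eps[OF sampling] by (auto simp: cond_mean_zero_def)
    note [measurable] = this
    have "\<bar>eps \<xi> X q s t \<omega> x * eps \<xi> X q s r \<omega> y\<bar> \<le> 1" if "\<omega> \<in> space M" for \<omega> y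
      using mult_mono[OF eps_bound[OF sampling that, of t x] eps_bound[OF sampling that, of r y]]
      by (simp add: abs_mult)
    then have "cond_mean_zero M (Xi_alg M \<xi>)
        (\<lambda>\<omega>. \<integral>y. (eps \<xi> X q s t \<omega> x * eps \<xi> X q s r \<omega> y) * \<psi> i y \<partial>\<mu>)"
      by (intro cond_mean_zero_integral[OF finite_mu] psi_integrable
          cond_mean_zero_eps_mult[OF sampling assms]) measurable
    moreover have "(\<integral>y. (eps \<xi> X q s t \<omega> x * eps \<xi> X q s r \<omega> y) * \<psi> i y \<partial>\<mu>)
        = innov \<xi> X q s \<mu> \<psi> r i \<omega> * eps \<xi> X q s t \<omega> x" for \<omega>
      by (simp add: innov_def L2_inner_def mult.assoc)
    ultimately show ?thesis
      by simp
  qed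
  have "\<bar>innov \<xi> X q s \<mu> \<psi> r i \<omega> * eps \<xi> X q s t \<omega> x\<bar> \<le> sqrt (measure \<mu> UNIV)"
    if "\<omega> \<in> space M" for \<omega> x
    using mult_mono[OF innov_bound[OF that, of r i] eps_bound[OF sampling that, of t x]]
    by (simp add: abs_mult)
  then have "cond_mean_zero M (Xi_alg M \<xi>)
      (\<lambda>\<omega>. \<integral>x. (innov \<xi> X q s \<mu> \<psi> r i \<omega> * eps \<xi> X q s t \<omega> x) * \<psi> j x \<partial>\<mu>)"
    by (intro cond_mean_zero_integral[OF finite_mu] psi_integrable inner) measurable
  moreover have "(\<integral>x. (innov \<xi> X q s \<mu> \<psi> r i \<omega> * eps \<xi> X q s t \<omega> x) * \<psi> j x \<partial>\<mu>)
      = innov \<xi> X q s \<mu> \<psi> t j \<omega> * innov \<xi> X q s \<mu> \<psi> r i \<omega>" for \<omega>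
    unfolding innov_def[of \<xi> X q s \<mu> \<psi> t] L2_inner_def by (simp add: mult.assoc)
  ultimately show ?thesis
    by simp
qed

text \<open>For fixed \<open>x\<close>, the factor \<open>F\<^sub>t(x) - E(x)\<close> is known given \<open>\<Xi>\<close>; only the inner product
  that defines \<open>W\<close> has to be integrated out.\<close>

lemma cond_mean_zero_W_mult_innov:
  "cond_mean_zero M (Xi_alg M \<xi>) (\<lambda>\<omega>. W M \<xi> \<mu> \<psi> t j \<omega> * innov \<xi> X q s \<mu> \<psi> r i \<omega>)"
proof -
  have [measurable_cong]: "sets \<mu> = sets borel" by (rule sets_mu)
  note [measurable] = cdf_jointly_measurable[OF xi_measurable sets_mu] cdf_xi_Xi_measurable
  have bound: "\<bar>cdf (\<xi> t \<omega>) x - mean_cdf M \<xi> x\<bar> \<le> 1" if "\<omega> \<in> space M" for \<omega> x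
    using cdf_bounds[OF xi_real_distribution[OF that], of t x] mean_cdf_bounds[of x] by linarith
  have "cond_mean_zero M (Xi_alg M \<xi>)
      (\<lambda>\<omega>. innov \<xi> X q s \<mu> \<psi> r i \<omega> * (cdf (\<xi> t \<omega>) x - mean_cdf M \<xi> x))" for x
    unfolding mult.commute[of "innov _ _ _ _ _ _ _ _ _"]
    by (intro cond_mean_zero_mult[where c=1] cond_mean_zero_innov bound) measurable
  moreover have "\<bar>innov \<xi> X q s \<mu> \<psi> r i \<omega> * (cdf (\<xi> t \<omega>) x - mean_cdf M \<xi> x)\<bar> \<le> sqrt (measure \<mu> UNIV)"
    if "\<omega> \<in> space M" for \<omega> x
    using mult_mono[OF innov_bound[OF that, of r i] bound[OF that, of x]] by (simp add: abs_mult)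
  ultimately have "cond_mean_zero M (Xi_alg M \<xi>)
      (\<lambda>\<omega>. \<integral>x. (innov \<xi> X q s \<mu> \<psi> r i \<omega> * (cdf (\<xi> t \<omega>) x - mean_cdf M \<xi> x)) * \<psi> j x \<partial>\<mu>)"
    by (intro cond_mean_zero_integral[OF finite_mu] psi_integrable) measurable
  moreover have "(\<integral>x. (innov \<xi> X q s \<mu> \<psi> r i \<omega> * (cdf (\<xi> t \<omega>) x - mean_cdf M \<xi> x)) * \<psi> j x \<partial>\<mu>)
      = W M \<xi> \<mu> \<psi> t j \<omega> * innov \<xi> X q s \<mu> \<psi> r i \<omega>" for \<omega>
    by (simp add: W_def L2_inner_def mult.assoc)
  ultimately show ?thesis
    by simp
qed

section \<open>Decomposition of the estimated scores\<close>

lemma W_measurable [measurable]: "W M \<xi> \<mu> \<psi> t j \<in> borel_measurable M"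
proof -
  interpret \<mu>: finite_measure \<mu> by (rule finite_mu)
  have [measurable_cong]: "sets \<mu> = sets borel" by (rule sets_mu)
  note [measurable] = cdf_jointly_measurable[OF xi_measurable sets_mu] L2_spaceD(1)[OF psi_L2]
  show ?thesis
    unfolding W_def[abs_def] L2_inner_def by measurable
qed

lemma W_hat_measurable:
  assumes \<phi>: "\<phi> j \<in> measurable M (L2_borel \<mu>)"
  shows "W_hat X q s n \<mu> \<phi> t j \<in> borel_measurable M"
proof -
  have L2: "\<phi> j \<omega> \<in> L2_space \<mu>" if "\<omega> \<in> space M" for \<omega>
    using measurable_space[OF \<phi> that] by (simp add: space_L2_borel)
  have half_line_L2: "(\<lambda>x. if a \<le> x then 1 else 0) \<in> L2_space \<mu>" for a
    by (rule L2_spaceI[where c=1]) auto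
  have F_hat: "(\<lambda>\<omega>. L2_inner \<mu> (F_hat X q s u \<omega>) (\<phi> j \<omega>)) \<in> borel_measurable M" for u
  proof -
    have "(\<lambda>\<omega>. 1 / real (q u) * (\<Sum>i=1..q u. L2_inner \<mu> (\<lambda>x. if X (s u i) \<omega> \<le> x then 1 else 0) (\<phi> j \<omega>)))
        \<in> borel_measurable M"
      by (intro borel_measurable_times borel_measurable_const borel_measurable_sum
          L2_inner_half_line_measurable finite_mu sets_mu sample_measurable[OF sampling] \<phi>)
    moreover have "L2_inner \<mu> (F_hat X q s u \<omega>) (\<phi> j \<omega>)
        = 1 / real (q u) * (\<Sum>i=1..q u. L2_inner \<mu> (\<lambda>x. if X (s u i) \<omega> \<le> x then 1 else 0) (\<phi> j \<omega>))"
      if "\<omega> \<in> space M" for \<omega>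
      unfolding F_hat_def[abs_def] by (rule L2_inner_scaled_sum_left[OF half_line_L2 L2[OF that]])
    ultimately show ?thesis
      by (simp cong: measurable_cong)
  qed
  have "(\<lambda>\<omega>. L2_inner \<mu> (F_hat X q s t \<omega>) (\<phi> j \<omega>)
      - 1 / real n * (\<Sum>u=1..n. L2_inner \<mu> (F_hat X q s u \<omega>) (\<phi> j \<omega>))) \<in> borel_measurable M"
    by (intro borel_measurable_diff borel_measurable_times borel_measurable_const
        borel_measurable_sum F_hat)
  moreover have "W_hat X q s n \<mu> \<phi> t j \<omega> = L2_inner \<mu> (F_hat X q s t \<omega>) (\<phi> j \<omega>)
      - 1 / real n * (\<Sum>u=1..n. L2_inner \<mu> (F_hat X q s u \<omega>) (\<phi> j \<omega>))" if "\<omega> \<in> space M" for \<omega>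
    unfolding W_hat_def L2_inner_diff_left[OF F_hat_L2 mean_cdf_hat_L2 L2[OF that]]
    unfolding mean_cdf_hat_def[abs_def] L2_inner_scaled_sum_left[OF F_hat_L2 L2[OF that]] ..
  ultimately show ?thesis
    by (simp cong: measurable_cong)
qed

text \<open>The remainder equals \<open>\<langle>Fh\<^sub>t - Eh, \<phi> - \<psi>\<rangle> - \<langle>Eh - E, \<psi>\<rangle>\<close>, where \<open>Fh\<^sub>t\<close> is the empirical
  distribution function, \<open>Eh\<close> its average over the cycles and \<open>E\<close> the mean distribution function;
  the factor \<open>Fh\<^sub>t - Eh\<close> takes values in \<open>[-1, 1]\<close>.\<close>

lemma W_hat_remainder_bound:
  assumes \<omega>: "\<omega> \<in> space M" and \<phi>: "\<phi> j \<omega> \<in> L2_space \<mu>"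
  shows "\<bar>W_hat X q s n \<mu> \<phi> t j \<omega> - W M \<xi> \<mu> \<psi> t j \<omega> - innov \<xi> X q s \<mu> \<psi> t j \<omega>\<bar>
    \<le> L2_norm \<mu> (\<lambda>x. mean_cdf_hat X q s n \<omega> x - mean_cdf M \<xi> x)
      + sqrt (measure \<mu> UNIV) * L2_norm \<mu> (\<lambda>x. \<phi> j \<omega> x - \<psi> j x)"
proof -
  let ?Fh = "F_hat X q s t \<omega>" and ?Eh = "mean_cdf_hat X q s n \<omega>" and ?E = "mean_cdf M \<xi>"
  let ?D = "\<lambda>x. ?Fh x - ?Eh x" and ?d = "\<lambda>x. \<phi> j \<omega> x - \<psi> j x" and ?e = "\<lambda>x. ?Eh x - ?E x"
  note L2 = F_hat_L2[of t \<omega>] mean_cdf_hat_L2[of n \<omega>] mean_cdf_L2 cdf_xi_L2[OF \<omega>, of t] psi_L2[of j] \<phi>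
  have D: "?D \<in> L2_space \<mu>" and d: "?d \<in> L2_space \<mu>" and e: "?e \<in> L2_space \<mu>"
    by (intro L2_space_diff L2)+
  have "\<bar>?D x\<bar> \<le> 1" for x
    using F_hat_bounds[OF sampling, of t \<omega> x] mean_cdf_hat_bounds[of n \<omega> x] by linarith
  then have "L2_norm \<mu> ?D \<le> sqrt (measure \<mu> UNIV)"
    using L2_norm_le_sqrt_measure[OF finite_mu L2_spaceD(1)[OF D]] by (simp add: space_mu)
  then have D_d: "\<bar>L2_inner \<mu> ?D ?d\<bar> \<le> sqrt (measure \<mu> UNIV) * L2_norm \<mu> ?d"
    by (intro order_trans[OF L2_Cauchy_Schwarz[OF D d]] mult_right_mono)
      (simp_all add: L2_norm_def L2_inner_self_nonneg)
  have e_psi: "\<bar>L2_inner \<mu> ?e (\<psi> j)\<bar> \<le> L2_norm \<mu> ?e"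
    using L2_Cauchy_Schwarz[OF e psi_L2[of j]] by (simp add: psi_norm)
  have "W_hat X q s n \<mu> \<phi> t j \<omega> - W M \<xi> \<mu> \<psi> t j \<omega> - innov \<xi> X q s \<mu> \<psi> t j \<omega>
      = L2_inner \<mu> ?D ?d - L2_inner \<mu> ?e (\<psi> j)"
    using D by (simp add: W_hat_def W_def innov_def eps_def[abs_def] L2_inner_diff_right
        L2_inner_diff_left L2)
  then show ?thesis
    using D_d e_psi by linarith
qed

end

theorem proposition2:
  fixes M :: "'a measure" and \<xi> :: "nat \<Rightarrow> 'a \<Rightarrow> real measure" and X :: "real \<Rightarrow> 'a \<Rightarrow> real"
    and \<mu> :: "real measure" and n p :: nat and q :: "nat \<Rightarrow> nat" and s :: "nat \<Rightarrow> nat \<Rightarrow> real"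
    and \<theta> :: "nat \<Rightarrow> real" and \<psi> :: "nat \<Rightarrow> real \<Rightarrow> real"
    and \<theta>h :: "nat \<Rightarrow> 'a \<Rightarrow> real" and \<psi>h :: "nat \<Rightarrow> 'a \<Rightarrow> real \<Rightarrow> real"
  assumes "prob_space M"
    and "stationary_random_measures M \<xi>"
    and "conjugate_process M \<xi> X"
    and "cyclic_independent M \<xi> X"
    and "diffraction M \<xi> \<mu>"
    and "1 \<le> p" and "p < n"
    and "eigensystem \<mu> (R_ker \<mu> p (C_ker M \<xi>)) \<theta> \<psi>"
    and "L2_closure \<mu> (op_range \<mu> (R_ker \<mu> p (C_ker M \<xi>))) = L2_closure \<mu> (op_range \<mu> (C_ker M \<xi> 0))"
    and "sampling_scheme q s"
    and "\<And>j. \<psi>h j \<in> measurable M (L2_borel \<mu>)"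
    and "AE \<omega> in M. eigensystem \<mu> (R_ker \<mu> p (C_hat X q s n p \<omega>)) (\<lambda>j. \<theta>h j \<omega>) (\<lambda>j. \<psi>h j \<omega>)"
  shows "(\<forall>j. \<forall>t\<in>{1..n}. \<exists>\<rho> \<in> borel_measurable M.
            (AE \<omega> in M. W_hat X q s n \<mu> \<psi>h t j \<omega> = W M \<xi> \<mu> \<psi> t j \<omega> + innov \<xi> X q s \<mu> \<psi> t j \<omega> + \<rho> \<omega>) \<and>
            (\<forall>\<omega>\<in>space M. \<bar>\<rho> \<omega>\<bar> \<le> L2_norm \<mu> (\<lambda>x. mean_cdf_hat X q s n \<omega> x - mean_cdf M \<xi> x)
               + 2 * sqrt (measure \<mu> UNIV) * L2_norm \<mu> (\<lambda>x. \<psi>h j \<omega> x - \<psi> j x)))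
       \<and> (\<forall>t j. cond_mean_zero M (Xi_alg M \<xi>) (innov \<xi> X q s \<mu> \<psi> t j))
       \<and> (\<forall>t r j i. t \<noteq> r \<longrightarrow> cond_mean_zero M (Xi_alg M \<xi>)
            (\<lambda>\<omega>. innov \<xi> X q s \<mu> \<psi> t j \<omega> * innov \<xi> X q s \<mu> \<psi> r i \<omega>))
       \<and> (\<forall>t r j i. cond_mean_zero M (Xi_alg M \<xi>)
            (\<lambda>\<omega>. W M \<xi> \<mu> \<psi> t j \<omega> * innov \<xi> X q s \<mu> \<psi> r i \<omega>))
       \<and> (\<forall>t j. \<forall>\<omega>\<in>space M. \<bar>innov \<xi> X q s \<mu> \<psi> t j \<omega>\<bar>
            \<le> L2_norm \<mu> (\<lambda>x. F_hat X q s t \<omega> x - cdf (\<xi> t \<omega>) x))"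
proof -
  interpret prob_space M by fact
  interpret \<mu>: finite_measure \<mu>
    using assms(5) by (simp add: diffraction_def)
  interpret sampled_L2_process M \<xi> X \<mu> \<psi> q s
  proof
    show "\<xi> t \<in> measurable M weak_borel" for t
      using assms(2) by (simp add: stationary_random_measures_def)
    show "sets \<mu> = sets borel"
      using assms(5) by (simp add: diffraction_def)
    show "\<psi> j \<in> L2_space \<mu>" "L2_norm \<mu> (\<psi> j) = 1" for j
      using assms(8) by (simp_all add: eigensystem_def eigenspace_def L2_norm_def)
  qed fact+
  have remainder: "\<exists>\<rho> \<in> borel_measurable M.
      (AE \<omega> in M. W_hat X q s n \<mu> \<psi>h t j \<omega> = W M \<xi> \<mu> \<psi> t j \<omega> + innov \<xi> X q s \<mu> \<psi> t j \<omega> + \<rho> \<omega>) \<and>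
      (\<forall>\<omega>\<in>space M. \<bar>\<rho> \<omega>\<bar> \<le> L2_norm \<mu> (\<lambda>x. mean_cdf_hat X q s n \<omega> x - mean_cdf M \<xi> x)
         + 2 * sqrt (measure \<mu> UNIV) * L2_norm \<mu> (\<lambda>x. \<psi>h j \<omega> x - \<psi> j x))" for t j
  proof (intro bexI conjI ballI)
    let ?\<rho> = "\<lambda>\<omega>. W_hat X q s n \<mu> \<psi>h t j \<omega> - W M \<xi> \<mu> \<psi> t j \<omega> - innov \<xi> X q s \<mu> \<psi> t j \<omega>"
    note [measurable] = W_hat_measurable[OF assms(11)]
    show "?\<rho> \<in> borel_measurable M"
      by measurable
    show "AE \<omega> in M. W_hat X q s n \<mu> \<psi>h t j \<omega> = W M \<xi> \<mu> \<psi> t j \<omega> + innov \<xi> X q s \<mu> \<psi> t j \<omega> + ?\<rho> \<omega>"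
      by simp
    fix \<omega> assume \<omega>: "\<omega> \<in> space M"
    have L2: "\<psi>h j \<omega> \<in> L2_space \<mu>"
      using measurable_space[OF assms(11) \<omega>] by (simp add: space_L2_borel)
    note bound = W_hat_remainder_bound[where \<phi>=\<psi>h and j=j and n=n and t=t, OF \<omega> L2]
    have "0 \<le> sqrt (measure \<mu> UNIV) * L2_norm \<mu> (\<lambda>x. \<psi>h j \<omega> x - \<psi> j x)"
      by (simp add: L2_norm_def L2_inner_self_nonneg)
    with bound show "\<bar>?\<rho> \<omega>\<bar> \<le> L2_norm \<mu> (\<lambda>x. mean_cdf_hat X q s n \<omega> x - mean_cdf M \<xi> x)
         + 2 * sqrt (measure \<mu> UNIV) * L2_norm \<mu> (\<lambda>x. \<psi>h j \<omega> x - \<psi> j x)"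
      by linarith
  qed
  show ?thesis
    by (intro conjI allI ballI impI remainder cond_mean_zero_innov cond_mean_zero_innov_mult
        cond_mean_zero_W_mult_innov innov_le_norm[unfolded eps_def[abs_def]])
qed

end
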